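(* Let $\xi$ be a primitive $p$th root of unity. The algebra automorphism $g\colon H_{\infty,1,n}\to H_{\infty,1,n}$ defined by $$g(X^{\varepsilon_1})=\xi X^{\varepsilon_1},\qquad\text{and}\qquad g(T_i)=T_i,\quad 2\le i\le n,$$ gives rise to an action of the group $\mathbb{Z}/p\mathbb{Z}=\{1,g,\ldots,g^{p-1}\}$ on $H_{\infty,1,n}$ by algebra automorphisms, and $$H_{\infty,p,n}=(H_{\infty,1,n})^{\mathbb{Z}/p\mathbb{Z}}$$ is the set of fixed points of the $\mathbb{Z}/p\mathbb{Z}$-action.
   Context: Here $n,p$ are positive integers and $q\in\mathbb{C}^*$. The affine braid group $\mathcal{B}_{\infty,1,n}$ is the group presented by generators $T_2,\ldots,T_n$ and $X^{\varepsilon_1}$ with relations: $T_iT_j=T_jT_i$ if $|i-j|>1$; $T_iT_{i+1}T_i=T_{i+1}T_iT_{i+1}$ for $2\le i\le n-1$; $X^{\varepsilon_1}T_2X^{\varepsilon_1}T_2=T_2X^{\varepsilon_1}T_2X^{\varepsilon_1}$; $X^{\varepsilon_1}T_i=T_iX^{\varepsilon_1}$ for $3\le i\le n$. Let $\kappa\colon\mathcal{B}_{\infty,1,n}\to\mathbb{Z}$ be the group homomorphism with $\kappa(X^{\varepsilon_1})=1$ and $\kappa(T_i)=0$ for $2\le i\le n$. The group $\mathcal{B}_{\infty,p,n}$ is the subgroup $\{b\in\mathcal{B}_{\infty,1,n}:\kappa(b)\equiv0\bmod p\}$. The affine Hecke algebra $H_{\infty,1,n}$ (resp. $H_{\infty,p,n}$)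 is the quotient of the group algebra $\mathbb{C}\mathcal{B}_{\infty,1,n}$ (resp. $\mathbb{C}\mathcal{B}_{\infty,p,n}$) by the relations $T_i^2=(q-q^{-1})T_i+1$, $2\le i\le n$. The algebras $H_{\infty,p,n}$ and $H_{\infty,1,n}$ are compared via the natural map induced by the inclusion $\mathcal{B}_{\infty,p,n}\subseteq\mathcal{B}_{\infty,1,n}$.
   Formalization: For n = 2 and p even the natural map from H_{∞,p,n} to H_{∞,1,n} is not injective (XT_2X^{-1} need not satisfy the quadratic relation in H_{∞,p,2}), so there only "image = fixed points" is claimed; in all other cases the natural map is also shown injective. *)

theory Defs
  imports "HOL-Algebra.Algebra" "HOL-Library.Poly_Mapping" Complex_Main
begin

section \<open>Groups given by generators and relations\<close>

text \<open>A letter \<open>(x, True)\<close> stands for the generator \<open>x\<close>, and \<open>(x, False)\<close> for its inverse.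
  A relation \<open>(u, v)\<close> stands for \<open>u = v\<close>.\<close>

type_synonym 'a word = "('a \<times> bool) list"

definition words :: "'a set \<Rightarrow> 'a word set" where
  "words S = lists (S \<times> UNIV)"

inductive pres_eq :: "'a set \<Rightarrow> ('a word \<times> 'a word) set \<Rightarrow> 'a word \<Rightarrow> 'a word \<Rightarrow> bool"
  for S R where
  refl: "u \<in> words S \<Longrightarrow> pres_eq S R u u"
| sym: "pres_eq S R u v \<Longrightarrow> pres_eq S R v u"
| trans: "pres_eq S R u v \<Longrightarrow> pres_eq S R v w \<Longrightarrow> pres_eq S R u w"
| cong: "pres_eq S R u u' \<Longrightarrow> pres_eq S R v v' \<Longrightarrow> pres_eq S R (u @ v) (u' @ v')"
| cancel: "x \<in> S \<Longrightarrow> pres_eq S R [(x, s), (x, \<not> s)] []"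
| rel: "(u, v) \<in> R \<Longrightarrow> u \<in> words S \<Longrightarrow> v \<in> words S \<Longrightarrow> pres_eq S R u v"

definition pres_class :: "'a set \<Rightarrow> ('a word \<times> 'a word) set \<Rightarrow> 'a word \<Rightarrow> 'a word set" where
  "pres_class S R u = {v. pres_eq S R u v}"

definition presented_group :: "'a set \<Rightarrow> ('a word \<times> 'a word) set \<Rightarrow> 'a word set monoid" where
  "presented_group S R =
    \<lparr>carrier = pres_class S R ` words S,
     monoid.mult = (\<lambda>A B. \<Union>u\<in>A. \<Union>v\<in>B. pres_class S R (u @ v)),
     one = pres_class S R []\<rparr>"

lemma pres_eq_words: "pres_eq S R u v \<Longrightarrow> u \<in> words S \<and> v \<in> words S"
  by (induction rule: pres_eq.induct) (auto simp: words_def)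

lemma pres_class_eq_iff:
  assumes "u \<in> words S"
  shows "pres_class S R u = pres_class S R v \<longleftrightarrow> pres_eq S R u v"
proof
  assume "pres_class S R u = pres_class S R v"
  moreover have "u \<in> pres_class S R u"
    using assms by (simp add: pres_class_def pres_eq.refl)
  ultimately have "pres_eq S R v u" by (simp add: pres_class_def)
  then show "pres_eq S R u v" by (rule pres_eq.sym)
next
  assume "pres_eq S R u v"
  then show "pres_class S R u = pres_class S R v"
    unfolding pres_class_def by (blast intro: pres_eq.trans pres_eq.sym)
qed

lemma pres_class_mult:
  assumes "u \<in> words S" "v \<in> words S"
  shows "pres_class S R u \<otimes>\<^bsub>presented_group S R\<^esub> pres_class S R v = pres_class S R (u @ v)"
proof -
  have eq: "pres_class S R (u' @ v') = pres_class S R (u @ v)"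
    if "u' \<in> pres_class S R u" "v' \<in> pres_class S R v" for u' v'
  proof -
    have e: "pres_eq S R (u @ v) (u' @ v')"
      using that unfolding pres_class_def by (blast intro: pres_eq.cong)
    then have "u @ v \<in> words S" by (blast dest: pres_eq_words)
    from pres_class_eq_iff[OF this, of R "u' @ v'"] e show ?thesis by simp
  qed
  have "u \<in> pres_class S R u" "v \<in> pres_class S R v"
    using assms by (simp_all add: pres_class_def pres_eq.refl)
  then have "(\<Union>u'\<in>pres_class S R u. \<Union>v'\<in>pres_class S R v. pres_class S R (u' @ v'))
      = pres_class S R (u @ v)"
    using eq by blast
  then show ?thesis unfolding presented_group_def by simp
qed

lemma words_append: "u @ v \<in> words S \<longleftrightarrow> u \<in> words S \<and> v \<in> words S"
  by (auto simp: words_def)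

lemma words_Nil: "[] \<in> words S"
  by (simp add: words_def)

lemma pres_left_inverse:
  "u \<in> words S \<Longrightarrow> pres_eq S R (rev (map (\<lambda>(x, s). (x, \<not> s)) u) @ u) []"
proof (induction u)
  case Nil
  then show ?case by (auto intro: pres_eq.refl)
next
  case (Cons a u)
  obtain x s where a: "a = (x, s)" by (cases a)
  let ?v = "rev (map (\<lambda>(x, s). (x, \<not> s)) u)"
  have u: "u \<in> words S" and x: "x \<in> S"
    using Cons.prems a by (auto simp: words_def)
  have IH: "pres_eq S R (?v @ u) []" using Cons.IH u by simp
  then have v: "?v \<in> words S"
    using pres_eq_words[OF IH] words_append by blast
  have "pres_eq S R [(x, \<not> s), (x, s)] []"
    using pres_eq.cancel[OF x, of R "\<not> s"] by simp
  from pres_eq.cong[OF pres_eq.refl[OF v] pres_eq.cong[OF this pres_eq.refl[OF u]]]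
  have "pres_eq S R (?v @ [(x, \<not> s), (x, s)] @ u) (?v @ u)" by simp
  from pres_eq.trans[OF this IH] show ?case using a by simp
qed

lemma group_presented_group: "group (presented_group S R)"
proof (rule groupI)
  let ?G = "presented_group S R"
  have car: "carrier ?G = pres_class S R ` words S" and one: "\<one>\<^bsub>?G\<^esub> = pres_class S R []"
    by (auto simp: presented_group_def)
  show "\<one>\<^bsub>?G\<^esub> \<in> carrier ?G" unfolding car one using words_Nil by blast
  fix a assume "a \<in> carrier ?G"
  then obtain u where u: "u \<in> words S" "a = pres_class S R u" unfolding car by blast
  show "\<one>\<^bsub>?G\<^esub> \<otimes>\<^bsub>?G\<^esub> a = a"
    using u by (simp add: one pres_class_mult words_Nil)
  show "\<exists>b\<in>carrier ?G. b \<otimes>\<^bsub>?G\<^esub> a = \<one>\<^bsub>?G\<^esub>"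
  proof -
    let ?v = "rev (map (\<lambda>(x, s). (x, \<not> s)) u)"
    have e: "pres_eq S R (?v @ u) []" by (rule pres_left_inverse[OF u(1)])
    have v: "?v \<in> words S" "?v @ u \<in> words S"
      using pres_eq_words[OF e] words_append by auto
    have "pres_class S R ?v \<otimes>\<^bsub>?G\<^esub> a = \<one>\<^bsub>?G\<^esub>"
      using pres_class_eq_iff[OF v(2)] e by (simp add: u pres_class_mult v one)
    then show ?thesis unfolding car using v(1) by blast
  qed
  fix b assume "b \<in> carrier ?G"
  then obtain v where v: "v \<in> words S" "b = pres_class S R v" unfolding car by blast
  show "a \<otimes>\<^bsub>?G\<^esub> b \<in> carrier ?G"
    using u v by (auto simp: car pres_class_mult words_append)
  fix c assume "c \<in> carrier ?G"
  then obtain w where w: "w \<in> words S" "c = pres_class S R w" unfolding car by blast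
  show "a \<otimes>\<^bsub>?G\<^esub> b \<otimes>\<^bsub>?G\<^esub> c = a \<otimes>\<^bsub>?G\<^esub> (b \<otimes>\<^bsub>?G\<^esub> c)"
    using u v w by (simp add: pres_class_mult words_append)
qed


section \<open>Affine braid groups\<close>

datatype braid_gen = X\<epsilon>1 | T nat

definition braid_gens :: "nat \<Rightarrow> braid_gen set" where
  "braid_gens n = insert X\<epsilon>1 (T ` {2..n})"

definition pos :: "'a list \<Rightarrow> 'a word" where
  "pos xs = map (\<lambda>x. (x, True)) xs"

definition braid_rels :: "nat \<Rightarrow> (braid_gen word \<times> braid_gen word) set" where
  "braid_rels n =
     {(pos [T i, T j], pos [T j, T i]) | i j.
        i \<in> {2..n} \<and> j \<in> {2..n} \<and> \<bar>int i - int j\<bar> > 1}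
   \<union> {(pos [T i, T (i+1), T i], pos [T (i+1), T i, T (i+1)]) | i. 2 \<le> i \<and> i + 1 \<le> n}
   \<union> (if 2 \<le> n then {(pos [X\<epsilon>1, T 2, X\<epsilon>1, T 2], pos [T 2, X\<epsilon>1, T 2, X\<epsilon>1])} else {})
   \<union> {(pos [X\<epsilon>1, T i], pos [T i, X\<epsilon>1]) | i. 3 \<le> i \<and> i \<le> n}"

type_synonym braid = "braid_gen word set"

definition braid_group :: "nat \<Rightarrow> braid monoid" where
  "braid_group n = presented_group (braid_gens n) (braid_rels n)"

definition braid_of_gen :: "nat \<Rightarrow> braid_gen \<Rightarrow> braid" where
  "braid_of_gen n x = pres_class (braid_gens n) (braid_rels n) [(x, True)]"

definition word_kappa :: "braid_gen word \<Rightarrow> int" where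
  "word_kappa w = (\<Sum>(x, s)\<leftarrow>w. if x = X\<epsilon>1 then (if s then 1 else - 1) else 0)"

definition kappa :: "braid \<Rightarrow> int" where
  "kappa b = the_elem (word_kappa ` b)"

text \<open>The set \<open>word_kappa ` b\<close> is a singleton for each group element \<open>b\<close>, and \<open>kappa\<close> is
  the homomorphism with value \<open>1\<close> on \<open>X\<epsilon>1\<close> and \<open>0\<close> on each \<open>T i\<close>:\<close>

lemma word_kappa_append: "word_kappa (u @ v) = word_kappa u + word_kappa v"
  by (simp add: word_kappa_def)

lemma word_kappa_cong:
  "pres_eq (braid_gens n) (braid_rels n) u v \<Longrightarrow> word_kappa u = word_kappa v"
proof (induction rule: pres_eq.induct)
  case (rel u v)
  then show ?case by (auto simp: braid_rels_def pos_def word_kappa_def split: if_splits)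
qed (auto simp: word_kappa_append, auto simp: word_kappa_def)

lemma kappa_class:
  assumes "u \<in> words (braid_gens n)"
  shows "kappa (pres_class (braid_gens n) (braid_rels n) u) = word_kappa u"
proof -
  have "word_kappa ` pres_class (braid_gens n) (braid_rels n) u = {word_kappa u}"
    using assms word_kappa_cong by (fastforce simp: pres_class_def intro: pres_eq.refl)
  then show ?thesis by (simp add: kappa_def)
qed

lemma kappa_hom: "kappa \<in> hom (braid_group n) integer_group"
proof (rule homI)
  fix a b assume "a \<in> carrier (braid_group n)" "b \<in> carrier (braid_group n)"
  then obtain u v where uv: "u \<in> words (braid_gens n)" "v \<in> words (braid_gens n)"
    "a = pres_class (braid_gens n) (braid_rels n) u"
    "b = pres_class (braid_gens n) (braid_rels n) v"
    by (auto simp: braid_group_def presented_group_def)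
  then show "kappa (a \<otimes>\<^bsub>braid_group n\<^esub> b) = kappa a \<otimes>\<^bsub>integer_group\<^esub> kappa b"
    by (simp add: braid_group_def pres_class_mult kappa_class words_append word_kappa_append)
qed simp

lemma kappa_X: "kappa (braid_of_gen n X\<epsilon>1) = 1"
  unfolding braid_of_gen_def
  by (subst kappa_class) (auto simp: words_def braid_gens_def word_kappa_def)

lemma kappa_T: "i \<in> {2..n} \<Longrightarrow> kappa (braid_of_gen n (T i)) = 0"
  unfolding braid_of_gen_def
  by (subst kappa_class) (auto simp: words_def braid_gens_def word_kappa_def)

definition braid_subgroup :: "nat \<Rightarrow> nat \<Rightarrow> braid monoid" where
  "braid_subgroup p n =
     (braid_group n)\<lparr>carrier := {b \<in> carrier (braid_group n). kappa b mod int p = 0}\<rparr>"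


section \<open>Associative complex algebras\<close>

text \<open>A complex algebra is a ring record extended by a scalar multiplication. The locale
  \<^locale>\<open>algebra\<close> of HOL-Algebra is not used since it requires commutativity.\<close>

definition alg_hom ::
    "(complex, 'a) module \<Rightarrow> (complex, 'b) module \<Rightarrow> ('a \<Rightarrow> 'b) set" where
  "alg_hom A B = {h \<in> ring_hom A B.
     \<forall>c. \<forall>x\<in>carrier A. h (c \<odot>\<^bsub>A\<^esub> x) = c \<odot>\<^bsub>B\<^esub> h x}"

definition alg_auto :: "(complex, 'a) module \<Rightarrow> ('a \<Rightarrow> 'a) set" where
  "alg_auto A = alg_hom A A \<inter> Bij (carrier A)"

definition quotient_algebra ::
    "(complex, 'a) module \<Rightarrow> 'a set \<Rightarrow> (complex, 'a set) module" where
  "quotient_algebra A I =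
     ring.extend (A Quot I) (module.fields (\<lambda>c C. \<Union>a\<in>C. I +>\<^bsub>A\<^esub> (c \<odot>\<^bsub>A\<^esub> a)))"

definition group_algebra :: "'g monoid \<Rightarrow> (complex, 'g \<Rightarrow>\<^sub>0 complex) module" where
  "group_algebra G =
    \<lparr>carrier = {f. Poly_Mapping.keys f \<subseteq> carrier G},
     monoid.mult = (\<lambda>f h. \<Sum>a\<in>Poly_Mapping.keys f. \<Sum>b\<in>Poly_Mapping.keys h.
               Poly_Mapping.single (a \<otimes>\<^bsub>G\<^esub> b)
                 (Poly_Mapping.lookup f a * Poly_Mapping.lookup h b)),
     one = Poly_Mapping.single \<one>\<^bsub>G\<^esub> 1,
     ring.zero = 0,
     ring.add = (+),
     module.smult = (\<lambda>c. Poly_Mapping.map (\<lambda>z. c * z))\<rparr>"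

lemma group_algebra_mult_superset:
  assumes "finite A" "Poly_Mapping.keys f \<subseteq> A" "finite B" "Poly_Mapping.keys h \<subseteq> B"
  shows "f \<otimes>\<^bsub>group_algebra G\<^esub> h = (\<Sum>a\<in>A. \<Sum>b\<in>B. Poly_Mapping.single (a \<otimes>\<^bsub>G\<^esub> b)
                 (Poly_Mapping.lookup f a * Poly_Mapping.lookup h b))"
proof -
  have "(\<Sum>b\<in>Poly_Mapping.keys h. Poly_Mapping.single (a \<otimes>\<^bsub>G\<^esub> b)
          (Poly_Mapping.lookup f a * Poly_Mapping.lookup h b)) =
        (\<Sum>b\<in>B. Poly_Mapping.single (a \<otimes>\<^bsub>G\<^esub> b)
          (Poly_Mapping.lookup f a * Poly_Mapping.lookup h b))" for a
    using assms by (intro sum.mono_neutral_left) (auto simp: in_keys_iff)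
  moreover have "(\<Sum>a\<in>Poly_Mapping.keys f. \<Sum>b\<in>B. Poly_Mapping.single (a \<otimes>\<^bsub>G\<^esub> b)
          (Poly_Mapping.lookup f a * Poly_Mapping.lookup h b)) =
        (\<Sum>a\<in>A. \<Sum>b\<in>B. Poly_Mapping.single (a \<otimes>\<^bsub>G\<^esub> b)
          (Poly_Mapping.lookup f a * Poly_Mapping.lookup h b))"
    using assms by (intro sum.mono_neutral_left) (auto simp: in_keys_iff)
  ultimately show ?thesis by (simp add: group_algebra_def)
qed

lemma group_algebra_single_mult:
  "Poly_Mapping.single a x \<otimes>\<^bsub>group_algebra G\<^esub> Poly_Mapping.single b y =
   Poly_Mapping.single (a \<otimes>\<^bsub>G\<^esub> b) (x * y)"
  by (subst group_algebra_mult_superset[of "{a}" _ "{b}"]) (auto split: if_splits)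

lemma group_algebra_add: "f \<oplus>\<^bsub>group_algebra G\<^esub> h = f + h"
  by (simp add: group_algebra_def)

lemma group_algebra_distrib_right:
  "(f + f') \<otimes>\<^bsub>group_algebra G\<^esub> h = f \<otimes>\<^bsub>group_algebra G\<^esub> h + f' \<otimes>\<^bsub>group_algebra G\<^esub> h"
proof -
  let ?A = "Poly_Mapping.keys f \<union> Poly_Mapping.keys f'"
  have sub: "Poly_Mapping.keys (f + f') \<subseteq> ?A" by (rule Poly_Mapping.keys_add)
  show ?thesis
    using sub
    by (simp add: group_algebra_mult_superset[of ?A _ "Poly_Mapping.keys h"] lookup_add
        distrib_right single_add sum.distrib)
qed

lemma group_algebra_distrib_left:
  "h \<otimes>\<^bsub>group_algebra G\<^esub> (f + f') = h \<otimes>\<^bsub>group_algebra G\<^esub> f + h \<otimes>\<^bsub>group_algebra G\<^esub> f'"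
proof -
  let ?A = "Poly_Mapping.keys f \<union> Poly_Mapping.keys f'"
  have sub: "Poly_Mapping.keys (f + f') \<subseteq> ?A" by (rule Poly_Mapping.keys_add)
  show ?thesis
    using sub
    by (simp add: group_algebra_mult_superset[of "Poly_Mapping.keys h" _ ?A] lookup_add
        distrib_left single_add sum.distrib)
qed

lemma group_algebra_induct [consumes 1, case_names single add zero]:
  fixes f :: "'g \<Rightarrow>\<^sub>0 complex" and G :: "'g monoid"
  assumes "Poly_Mapping.keys f \<subseteq> carrier G"
    and "\<And>a c. a \<in> carrier G \<Longrightarrow> P (Poly_Mapping.single a c)"
    and "\<And>f h. P f \<Longrightarrow> P h \<Longrightarrow> P (f + h)"
    and "P 0"
  shows "P f"
proof -
  have "P (\<Sum>a\<in>B. Poly_Mapping.single a (Poly_Mapping.lookup f a))"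
    if "finite B" "B \<subseteq> carrier G" for B
    using that by (induction B rule: finite_induct) (auto intro: assms)
  from this[OF finite_keys assms(1)]
  have "P (\<Sum>a\<in>Poly_Mapping.keys f. Poly_Mapping.single a (Poly_Mapping.lookup f a))" .
  also have "(\<Sum>a\<in>Poly_Mapping.keys f. Poly_Mapping.single a (Poly_Mapping.lookup f a)) = f"
    by (rule poly_mapping_eqI)
      (auto simp: lookup_sum lookup_single when_def in_keys_iff sum.delta)
  finally show ?thesis .
qed

lemma ring_group_algebra:
  assumes "group G"
  shows "ring (group_algebra G)"
proof -
  interpret group G by fact
  let ?A = "group_algebra G"
  have car: "carrier ?A = {f. Poly_Mapping.keys f \<subseteq> carrier G}"
    and zero: "\<zero>\<^bsub>?A\<^esub> = 0" and one: "\<one>\<^bsub>?A\<^esub> = Poly_Mapping.single \<one>\<^bsub>G\<^esub> 1"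
    by (auto simp: group_algebra_def)
  have z: "0 \<otimes>\<^bsub>?A\<^esub> f = 0" "f \<otimes>\<^bsub>?A\<^esub> 0 = 0" for f
    by (auto simp: group_algebra_def)
  have plus: "f + h \<in> carrier ?A" if "f \<in> carrier ?A" "h \<in> carrier ?A" for f h
  proof -
    have "Poly_Mapping.keys f \<union> Poly_Mapping.keys h \<subseteq> carrier G"
      using that by (simp add: car)
    then show ?thesis using Poly_Mapping.keys_add[of f h] by (auto simp: car)
  qed
  have closed: "f \<otimes>\<^bsub>?A\<^esub> h \<in> carrier ?A" if "f \<in> carrier ?A" "h \<in> carrier ?A" for f h
  proof -
    have "Poly_Mapping.keys f \<subseteq> carrier G" using that car by simp
    then show ?thesis
    proof (induction f rule: group_algebra_induct)
      case (single a c)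
      have "Poly_Mapping.keys h \<subseteq> carrier G" using that car by simp
      then show ?case
      proof (induction h rule: group_algebra_induct)
        case (single b d)
        then show ?case using \<open>a \<in> carrier G\<close>
          by (auto simp: group_algebra_single_mult car)
      next
        case (add f h)
        then show ?case by (simp add: group_algebra_distrib_left plus)
      qed (simp add: z car)
    next
      case (add f h)
      then show ?case by (simp add: group_algebra_distrib_right plus)
    qed (simp add: z car)
  qed
  have assoc: "f \<otimes>\<^bsub>?A\<^esub> h \<otimes>\<^bsub>?A\<^esub> k = f \<otimes>\<^bsub>?A\<^esub> (h \<otimes>\<^bsub>?A\<^esub> k)"
    if "f \<in> carrier ?A" "h \<in> carrier ?A" "k \<in> carrier ?A" for f h k
  proof -
    have f: "Poly_Mapping.keys f \<subseteq> carrier G" and h: "Poly_Mapping.keys h \<subseteq> carrier G"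
      and k: "Poly_Mapping.keys k \<subseteq> carrier G"
      using that car by auto
    from f show ?thesis
    proof (induction f rule: group_algebra_induct)
      case a: (single a c)
      from h show ?case
      proof (induction h rule: group_algebra_induct)
        case b: (single b d)
        from k show ?case
        proof (induction k rule: group_algebra_induct)
          case (single e x)
          with a b show ?case by (simp add: group_algebra_single_mult m_assoc mult.assoc)
        qed (auto simp: group_algebra_distrib_left z)
      qed (auto simp: group_algebra_distrib_left group_algebra_distrib_right z)
    qed (auto simp: group_algebra_distrib_right z)
  qed
  have unit: "\<one>\<^bsub>?A\<^esub> \<otimes>\<^bsub>?A\<^esub> f = f" "f \<otimes>\<^bsub>?A\<^esub> \<one>\<^bsub>?A\<^esub> = f" if "f \<in> carrier ?A" for f
  proof -
    have f: "Poly_Mapping.keys f \<subseteq> carrier G" using that car by simp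
    from f show "\<one>\<^bsub>?A\<^esub> \<otimes>\<^bsub>?A\<^esub> f = f"
      by (induction f rule: group_algebra_induct)
        (auto simp: one group_algebra_single_mult group_algebra_distrib_left z)
    from f show "f \<otimes>\<^bsub>?A\<^esub> \<one>\<^bsub>?A\<^esub> = f"
      by (induction f rule: group_algebra_induct)
        (auto simp: one group_algebra_single_mult group_algebra_distrib_right z)
  qed
  show ?thesis
  proof (rule ringI)
    show "abelian_group ?A"
    proof (rule abelian_groupI)
      fix f h assume "f \<in> carrier ?A" "h \<in> carrier ?A"
      then show "f \<oplus>\<^bsub>?A\<^esub> h \<in> carrier ?A"
        by (simp add: group_algebra_add plus)
    next
      fix f assume "f \<in> carrier ?A"
      then have "- f \<in> carrier ?A" "- f \<oplus>\<^bsub>?A\<^esub> f = \<zero>\<^bsub>?A\<^esub>"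
        by (auto simp: car zero group_algebra_add in_keys_iff)
      then show "\<exists>h\<in>carrier ?A. h \<oplus>\<^bsub>?A\<^esub> f = \<zero>\<^bsub>?A\<^esub>" by blast
    qed (auto simp: car zero group_algebra_add add_ac)
    show "Group.monoid ?A"
    proof (rule Group.monoidI)
      show "\<one>\<^bsub>?A\<^esub> \<in> carrier ?A" by (simp add: one car)
    qed (use closed assoc unit in blast)+
  qed (auto simp: group_algebra_add group_algebra_distrib_left group_algebra_distrib_right)
qed


section \<open>Affine Hecke algebras\<close>

text \<open>In the following, \<open>G\<close> is the affine braid group on the generators \<open>X\<epsilon>1, T 2, ..., T n\<close> or
  one of its subgroups \<^term>\<open>braid_subgroup p n\<close>. The ideal is generated inside the group algebra
  of \<open>G\<close>, by the quadratic relations for the elements \<open>T i\<close> themselves.\<close>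

definition hecke_relators :: "complex \<Rightarrow> nat \<Rightarrow> braid monoid \<Rightarrow> (braid \<Rightarrow>\<^sub>0 complex) set" where
  "hecke_relators q n G =
     (let A = group_algebra G; t = (\<lambda>i. Poly_Mapping.single (braid_of_gen n (T i)) 1)
      in {(t i \<otimes>\<^bsub>A\<^esub> t i) \<ominus>\<^bsub>A\<^esub> (((q - inverse q) \<odot>\<^bsub>A\<^esub> t i) \<oplus>\<^bsub>A\<^esub> \<one>\<^bsub>A\<^esub>) | i. i \<in> {2..n}})"

definition hecke_ideal :: "complex \<Rightarrow> nat \<Rightarrow> braid monoid \<Rightarrow> (braid \<Rightarrow>\<^sub>0 complex) set" where
  "hecke_ideal q n G = Idl\<^bsub>group_algebra G\<^esub> (hecke_relators q n G)"

type_synonym hecke = "(braid \<Rightarrow>\<^sub>0 complex) set"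

definition hecke_of :: "complex \<Rightarrow> nat \<Rightarrow> braid monoid \<Rightarrow> (complex, hecke) module" where
  "hecke_of q n G = quotient_algebra (group_algebra G) (hecke_ideal q n G)"

definition affine_hecke :: "complex \<Rightarrow> nat \<Rightarrow> (complex, hecke) module" where
  "affine_hecke q n = hecke_of q n (braid_group n)"

definition affine_hecke_p :: "complex \<Rightarrow> nat \<Rightarrow> nat \<Rightarrow> (complex, hecke) module" where
  "affine_hecke_p q p n = hecke_of q n (braid_subgroup p n)"

definition hecke_gen :: "complex \<Rightarrow> nat \<Rightarrow> braid_gen \<Rightarrow> hecke" where
  "hecke_gen q n x = hecke_ideal q n (braid_group n)
     +>\<^bsub>group_algebra (braid_group n)\<^esub> Poly_Mapping.single (braid_of_gen n x) 1"

text \<open>The group algebra of the subgroup is literally contained in that of the whole group, so the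
  map induced by the inclusion sends the coset of \<open>a\<close> to the coset of \<open>a\<close> modulo the larger ideal.

  It is not injective for \<open>n = 2\<close> and even \<open>p\<close>. Write \<open>X, T\<close> for the two generators, and
  let \<open>e\<close> (resp. \<open>o\<close>) be the sum of the exponents of those letters \<open>T\<close> of a word that are preceded by an
  \<open>X\<close>-prefix of even (resp. odd) exponent sum. The braid relation preserves \<open>e\<close> and \<open>o\<close>, so that
  \<open>b \<mapsto> q^e(b) * a^o(b)\<close> is a character of the subgroup for every nonzero \<open>a\<close>. It sends \<open>T\<close> to
  \<open>q\<close>, hence factors through the quotient of the group algebra of the subgroup, but it sends the
  conjugate \<open>X T X^-1\<close>, which lies in the subgroup, to \<open>a\<close>. So the conjugate does not satisfy
  the quadratic relation there, whereas it does in the algebra for the whole group.\<close>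

definition natural_map :: "complex \<Rightarrow> nat \<Rightarrow> nat \<Rightarrow> hecke \<Rightarrow> hecke" where
  "natural_map q p n = (\<lambda>C\<in>carrier (affine_hecke_p q p n).
     \<Union>a\<in>C. hecke_ideal q n (braid_group n) +>\<^bsub>group_algebra (braid_group n)\<^esub> a)"


section \<open>The cyclic group action\<close>

definition primitive_root_of_unity :: "nat \<Rightarrow> complex \<Rightarrow> bool" where
  "primitive_root_of_unity p \<xi> \<longleftrightarrow> \<xi> ^ p = 1 \<and> (\<forall>k. 0 < k \<and> k < p \<longrightarrow> \<xi> ^ k \<noteq> 1)"

definition twist_auto :: "complex \<Rightarrow> nat \<Rightarrow> complex \<Rightarrow> (hecke \<Rightarrow> hecke) \<Rightarrow> bool" where
  "twist_auto q n \<xi> g \<longleftrightarrow>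
     g \<in> alg_auto (affine_hecke q n) \<and>
     g (hecke_gen q n X\<epsilon>1) = \<xi> \<odot>\<^bsub>affine_hecke q n\<^esub> hecke_gen q n X\<epsilon>1 \<and>
     (\<forall>i\<in>{2..n}. g (hecke_gen q n (T i)) = hecke_gen q n (T i))"

definition power_action :: "'a set \<Rightarrow> ('a \<Rightarrow> 'a) \<Rightarrow> int \<Rightarrow> 'a \<Rightarrow> 'a" where
  "power_action E g k = g [^]\<^bsub>BijGroup E\<^esub> k"

definition fixed_points :: "('g, 'm) monoid_scheme \<Rightarrow> 'a set \<Rightarrow> ('g \<Rightarrow> 'a \<Rightarrow> 'a) \<Rightarrow> 'a set" where
  "fixed_points G E \<phi> = {x \<in> E. \<forall>k\<in>carrier G. \<phi> k x = x}"

end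

theory Submission
  imports Defs
begin

text \<open>The group algebra of the braid group is graded by \<^const>\<open>kappa\<close>, and the defining ideal of the
  affine Hecke algebra is generated in degree \<open>0\<close>. The automorphism \<open>g\<close> multiplies the part of
  degree \<open>m\<close> by \<open>\<xi>^m\<close>; averaging over its powers projects onto the degrees divisible by \<open>p\<close>, which
  shows that every fixed point comes from \<^const>\<open>braid_subgroup\<close>.

  For injectivity, the same projection maps the ideal of the large group algebra into the ideal of the
  small one as soon as the latter contains the quadratic relator of every conjugate \<open>a T i a^-1\<close>.
  This holds if \<open>a\<close> can be replaced by an element of the subgroup. If \<open>i > 2\<close>, multiply \<open>a\<close> by a
  power of \<open>X\<epsilon>1\<close>, which commutes with \<open>T i\<close>. If \<open>n > 2\<close>, then \<open>T 2\<close> is conjugate to \<open>T 3\<close> in degree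
  \<open>0\<close>. If \<open>n = 2\<close> and \<open>p\<close> is odd, multiply \<open>a\<close> by a power of \<open>X\<epsilon>1 T 2 X\<epsilon>1 T 2\<close>, which commutes
  with \<open>T 2\<close> and has degree \<open>2\<close>, a unit modulo \<open>p\<close>.\<close>


section \<open>Group algebras\<close>

lemma group_algebra_simps:
  "carrier (group_algebra G) = {f. Poly_Mapping.keys f \<subseteq> carrier G}"
  "\<zero>\<^bsub>group_algebra G\<^esub> = 0"
  "\<one>\<^bsub>group_algebra G\<^esub> = Poly_Mapping.single \<one>\<^bsub>G\<^esub> 1"
  by (auto simp: group_algebra_def)

lemma single_carrier: "a \<in> carrier G \<Longrightarrow> Poly_Mapping.single a c \<in> carrier (group_algebra G)"
  by (simp add: group_algebra_simps)

lemma lookup_group_algebra_smult: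
  "Poly_Mapping.lookup (c \<odot>\<^bsub>group_algebra G\<^esub> f) a = c * Poly_Mapping.lookup f a"
  by (simp add: group_algebra_def Poly_Mapping.map.rep_eq when_def)

lemma group_algebra_smult_single:
  "c \<odot>\<^bsub>group_algebra G\<^esub> Poly_Mapping.single a d = Poly_Mapping.single a (c * d)"
  by (rule poly_mapping_eqI) (simp add: lookup_group_algebra_smult lookup_single when_def)

lemma group_algebra_smult_minus:
  "c \<odot>\<^bsub>group_algebra G\<^esub> (f - h) = c \<odot>\<^bsub>group_algebra G\<^esub> f - c \<odot>\<^bsub>group_algebra G\<^esub> h"
  by (rule poly_mapping_eqI) (simp add: lookup_group_algebra_smult lookup_minus algebra_simps)

lemma group_algebra_smult_smult:
  "c \<odot>\<^bsub>group_algebra G\<^esub> (d \<odot>\<^bsub>group_algebra G\<^esub> f) = (c * d) \<odot>\<^bsub>group_algebra G\<^esub> f"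
  by (rule poly_mapping_eqI) (simp add: lookup_group_algebra_smult)

lemma group_algebra_smult_one: "1 \<odot>\<^bsub>group_algebra G\<^esub> f = f"
  by (rule poly_mapping_eqI) (simp add: lookup_group_algebra_smult)

lemma group_algebra_zero_mult:
  "0 \<otimes>\<^bsub>group_algebra G\<^esub> f = 0" "f \<otimes>\<^bsub>group_algebra G\<^esub> 0 = 0"
  by (auto simp: group_algebra_def)

lemma group_algebra_smult_mult:
  "(c \<odot>\<^bsub>group_algebra G\<^esub> f) \<otimes>\<^bsub>group_algebra G\<^esub> h = c \<odot>\<^bsub>group_algebra G\<^esub> (f \<otimes>\<^bsub>group_algebra G\<^esub> h)"
proof -
  \<comment> \<open>For \<open>c = 0\<close> the support shrinks, so both products are expanded over
    the support of \<open>f\<close>.\<close>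
  have "Poly_Mapping.keys (c \<odot>\<^bsub>group_algebra G\<^esub> f) \<subseteq> Poly_Mapping.keys f"
    by (auto simp: in_keys_iff lookup_group_algebra_smult)
  then show ?thesis
    by (subst (1 2) group_algebra_mult_superset[of "Poly_Mapping.keys f" _ "Poly_Mapping.keys h"])
      (auto intro!: poly_mapping_eqI sum.cong
        simp: lookup_group_algebra_smult lookup_sum lookup_single sum_distrib_left when_def)
qed

context
  fixes G :: "'g monoid"
  assumes G: "group G"
begin

interpretation group G by (rule G)
interpretation A: ring "group_algebra G" by (rule ring_group_algebra[OF G])

lemma group_algebra_minus_closed:
  "f \<in> carrier (group_algebra G) \<Longrightarrow> h \<in> carrier (group_algebra G) \<Longrightarrow>
    f - h \<in> carrier (group_algebra G)"
  using keys_diff[of f h] by (auto simp: group_algebra_simps)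

lemma group_algebra_a_minus:
  assumes "f \<in> carrier (group_algebra G)" "h \<in> carrier (group_algebra G)"
  shows "f \<ominus>\<^bsub>group_algebra G\<^esub> h = f - h"
proof -
  have "\<ominus>\<^bsub>group_algebra G\<^esub> h = - h"
    using assms by (intro A.minus_equality) (auto simp: group_algebra_simps group_algebra_add in_keys_iff)
  then show ?thesis by (simp add: a_minus_def group_algebra_add)
qed

text \<open>Scalars act through multiples of the unit, which are elements of the algebra; hence
  every ring ideal is stable under scalars.\<close>

lemma group_algebra_smult_eq_mult:
  assumes "f \<in> carrier (group_algebra G)"
  shows "c \<odot>\<^bsub>group_algebra G\<^esub> f = Poly_Mapping.single \<one>\<^bsub>G\<^esub> c \<otimes>\<^bsub>group_algebra G\<^esub> f"
proof -
  have "Poly_Mapping.single \<one>\<^bsub>G\<^esub> c \<otimes>\<^bsub>group_algebra G\<^esub> f =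
      (c \<odot>\<^bsub>group_algebra G\<^esub> \<one>\<^bsub>group_algebra G\<^esub>) \<otimes>\<^bsub>group_algebra G\<^esub> f"
    by (simp add: group_algebra_simps group_algebra_smult_single)
  then show ?thesis using assms by (simp add: group_algebra_smult_mult)
qed

end


text \<open>Negation is multiplication by \<open>\<ominus> \<one>\<close>, so stability under
  multiplication covers it.\<close>

lemma (in ring) idealI_closed:
  assumes "K \<subseteq> carrier R" "\<zero> \<in> K"
    and "\<And>x y. x \<in> K \<Longrightarrow> y \<in> K \<Longrightarrow> x \<oplus> y \<in> K"
    and l: "\<And>x y. x \<in> K \<Longrightarrow> y \<in> carrier R \<Longrightarrow> y \<otimes> x \<in> K"
    and "\<And>x y. x \<in> K \<Longrightarrow> y \<in> carrier R \<Longrightarrow> x \<otimes> y \<in> K"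
  shows "ideal K R"
proof (rule idealI)
  show "subgroup K (add_monoid R)"
  proof (rule add.subgroupI)
    fix x assume x: "x \<in> K"
    then have "\<ominus> \<one> \<otimes> x \<in> K" by (intro l) auto
    moreover have "\<ominus> \<one> \<otimes> x = \<ominus> x" using x assms(1) l_minus by auto
    ultimately show "\<ominus> x \<in> K" by simp
  qed (use assms in auto)
qed (use assms ring_axioms in auto)

lemma alg_hom_group_algebra_simps:
  assumes "\<phi> \<in> alg_hom (group_algebra G) (group_algebra H)"
  shows "f \<in> carrier (group_algebra G) \<Longrightarrow> \<phi> f \<in> carrier (group_algebra H)"
    "f \<in> carrier (group_algebra G) \<Longrightarrow> h \<in> carrier (group_algebra G) \<Longrightarrow>
      \<phi> (f \<otimes>\<^bsub>group_algebra G\<^esub> h) = \<phi> f \<otimes>\<^bsub>group_algebra H\<^esub> \<phi> h"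
    "f \<in> carrier (group_algebra G) \<Longrightarrow> h \<in> carrier (group_algebra G) \<Longrightarrow> \<phi> (f + h) = \<phi> f + \<phi> h"
    "\<phi> \<one>\<^bsub>group_algebra G\<^esub> = \<one>\<^bsub>group_algebra H\<^esub>"
    "f \<in> carrier (group_algebra G) \<Longrightarrow> \<phi> (c \<odot>\<^bsub>group_algebra G\<^esub> f) = c \<odot>\<^bsub>group_algebra H\<^esub> \<phi> f"
  using assms ring_hom_add[of \<phi> "group_algebra G" "group_algebra H" f h]
  by (auto simp: alg_hom_def ring_hom_closed ring_hom_mult ring_hom_one group_algebra_add)

text \<open>The preimage of \<open>J\<close> under \<open>\<phi>\<close> is an ideal containing
  \<open>S\<close>. It thus suffices to test a homomorphism on generators; this serves the twist,
  the inclusion of the subgroup and a character.\<close>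

lemma alg_hom_genideal:
  assumes G: "group G" and "ideal J (group_algebra H)"
    and \<phi>: "\<phi> \<in> alg_hom (group_algebra G) (group_algebra H)"
    and S: "S \<subseteq> carrier (group_algebra G)" "\<phi> ` S \<subseteq> J"
  shows "\<phi> ` (Idl\<^bsub>group_algebra G\<^esub> S) \<subseteq> J"
proof -
  interpret A: ring "group_algebra G" by (rule ring_group_algebra[OF G])
  interpret J: ideal J "group_algebra H" by fact
  note \<phi>_simps = alg_hom_group_algebra_simps[OF \<phi>]
  let ?K = "{f \<in> carrier (group_algebra G). \<phi> f \<in> J}"
  have add: "f + h \<in> carrier (group_algebra G)"
    if "f \<in> carrier (group_algebra G)" "h \<in> carrier (group_algebra G)" for f h
    using A.add.m_closed[OF that] by (simp add: group_algebra_add)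
  \<comment> \<open>\<open>ring_hom\<close> demands only sums, products and the unit, so the value
    at \<open>0\<close> is derived from \<open>0 + 0 = 0\<close>.\<close>
  have "\<phi> 0 = 0"
    using \<phi>_simps(3)[OF A.zero_closed A.zero_closed] by (simp add: group_algebra_simps)
  then have zero: "\<zero>\<^bsub>group_algebra G\<^esub> \<in> ?K"
    using additive_subgroup.zero_closed[OF J.is_additive_subgroup] A.zero_closed
    by (simp add: group_algebra_simps)
  have "ideal ?K (group_algebra G)"
    using zero additive_subgroup.a_closed[OF J.is_additive_subgroup]
    by (intro A.idealI_closed)
      (auto simp: \<phi>_simps group_algebra_add add J.I_l_closed J.I_r_closed)
  then have "Idl\<^bsub>group_algebra G\<^esub> S \<subseteq> ?K"
    using S by (intro A.genideal_minimal) auto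
  then show ?thesis by auto
qed


section \<open>Quotients of group algebras\<close>

locale group_algebra_ideal =
  fixes G :: "'g monoid" and I :: "('g \<Rightarrow>\<^sub>0 complex) set"
  assumes group_G: "group G" and ideal_I: "ideal I (group_algebra G)"
begin

abbreviation "A \<equiv> group_algebra G"
abbreviation "Q \<equiv> quotient_algebra A I"
abbreviation coset where "coset f \<equiv> I +>\<^bsub>A\<^esub> f"

interpretation ideal I A by (rule ideal_I)

lemma one_carrier: "\<one>\<^bsub>A\<^esub> \<in> carrier A"
  by (rule one_closed)

lemma add_carrier: "f \<in> carrier A \<Longrightarrow> h \<in> carrier A \<Longrightarrow> f + h \<in> carrier A"
  using add.m_closed[of f h] by (simp add: group_algebra_add)

lemma mult_carrier: "f \<in> carrier A \<Longrightarrow> h \<in> carrier A \<Longrightarrow> f \<otimes>\<^bsub>A\<^esub> h \<in> carrier A"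
  by (rule m_closed)

lemma zero_mem: "0 \<in> I"
  using additive_subgroup.zero_closed[OF is_additive_subgroup] by (simp add: group_algebra_simps)

lemma add_mem: "f \<in> I \<Longrightarrow> h \<in> I \<Longrightarrow> f + h \<in> I"
  using additive_subgroup.a_closed[OF is_additive_subgroup, of f h] by (simp add: group_algebra_add)

lemma smult_mem: "f \<in> I \<Longrightarrow> c \<odot>\<^bsub>A\<^esub> f \<in> I"
  using group_algebra_smult_eq_mult[OF group_G Icarr, of f c] I_l_closed[of f "Poly_Mapping.single \<one>\<^bsub>G\<^esub> c"]
    group.is_monoid[OF group_G]
  by (auto simp: group_algebra_simps monoid.one_closed)

lemma smult_mem_iff: "c \<noteq> 0 \<Longrightarrow> c \<odot>\<^bsub>A\<^esub> f \<in> I \<longleftrightarrow> f \<in> I"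
  using smult_mem[of "c \<odot>\<^bsub>A\<^esub> f" "inverse c"] smult_mem[of f c]
  by (auto simp: group_algebra_smult_smult group_algebra_smult_one)

lemma sum_mem: "(\<And>i. i \<in> K \<Longrightarrow> h i \<in> I) \<Longrightarrow> sum h K \<in> I"
  by (induction K rule: infinite_finite_induct) (auto intro: zero_mem add_mem)

lemma smult_carrier: "f \<in> carrier A \<Longrightarrow> c \<odot>\<^bsub>A\<^esub> f \<in> carrier A"
  by (auto simp: group_algebra_simps in_keys_iff lookup_group_algebra_smult)

lemma coset_eq_iff:
  assumes "f \<in> carrier A" "h \<in> carrier A"
  shows "coset f = coset h \<longleftrightarrow> f - h \<in> I"
  using quotient_eq_iff_same_a_r_cos[OF ideal_I assms] group_algebra_a_minus[OF group_G assms] by simp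

lemma mem_coset: "h \<in> coset f \<Longrightarrow> f \<in> carrier A \<Longrightarrow> h \<in> carrier A \<and> coset h = coset f"
  by (metis a_elemrcos_carrier a_repr_independence')

lemma mem_coset_self: "f \<in> carrier A \<Longrightarrow> f \<in> coset f"
  by (rule a_rcos_self)

lemma carrier_Q: "carrier Q = coset ` carrier A"
  by (auto simp: quotient_algebra_def ring.defs module.defs FactRing_def A_RCOSETS_def')

lemma coset_carrier: "f \<in> carrier A \<Longrightarrow> coset f \<in> carrier Q"
  by (simp add: carrier_Q)

lemma coset_mult: "f \<in> carrier A \<Longrightarrow> h \<in> carrier A \<Longrightarrow> coset f \<otimes>\<^bsub>Q\<^esub> coset h = coset (f \<otimes>\<^bsub>A\<^esub> h)"
  by (simp add: quotient_algebra_def ring.defs FactRing_def rcoset_mult_add)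

lemma coset_add: "f \<in> carrier A \<Longrightarrow> h \<in> carrier A \<Longrightarrow> coset f \<oplus>\<^bsub>Q\<^esub> coset h = coset (f + h)"
  using a_rcos_sum[of f h]
  by (simp add: quotient_algebra_def ring.defs FactRing_def group_algebra_add)

lemma coset_one: "\<one>\<^bsub>Q\<^esub> = coset \<one>\<^bsub>A\<^esub>"
  by (simp add: quotient_algebra_def ring.defs FactRing_def)

text \<open>Scalar multiplication on the quotient and the induced maps are defined as unions over
  all representatives of a coset; such a union collapses once its members agree.\<close>

lemma UN_coset_eq:
  assumes f: "f \<in> carrier A" and F: "\<And>h. h \<in> carrier A \<Longrightarrow> coset h = coset f \<Longrightarrow> F h = F f"
  shows "(\<Union>h\<in>coset f. F h) = F f"
  using mem_coset[OF _ f] mem_coset_self[OF f] F by blast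

lemma coset_smult:
  assumes "f \<in> carrier A"
  shows "c \<odot>\<^bsub>Q\<^esub> coset f = coset (c \<odot>\<^bsub>A\<^esub> f)"
proof -
  have "c \<odot>\<^bsub>Q\<^esub> coset f = (\<Union>h\<in>coset f. coset (c \<odot>\<^bsub>A\<^esub> h))"
    by (simp add: quotient_algebra_def ring.defs module.defs)
  also have "\<dots> = coset (c \<odot>\<^bsub>A\<^esub> f)"
    using assms by (intro UN_coset_eq)
      (simp_all add: coset_eq_iff smult_carrier smult_mem flip: group_algebra_smult_minus)
  finally show ?thesis .
qed

end

text \<open>The restriction to the carrier makes the map extensional, as membership in
  \<open>Bij\<close> demands, so that equality of such maps is a matter of values on cosets.
  \<open>natural_map\<close> has the same shape.\<close>

definition induced_map ::
    "(complex, 'a) module \<Rightarrow> 'a set \<Rightarrow> (complex, 'b) module \<Rightarrow> 'b set \<Rightarrow> ('a \<Rightarrow> 'b) \<Rightarrow> 'a set \<Rightarrow> 'b set" where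
  "induced_map A I B J \<phi> = (\<lambda>C\<in>carrier (quotient_algebra A I). \<Union>a\<in>C. J +>\<^bsub>B\<^esub> \<phi> a)"

locale group_algebra_ideal_hom =
  source: group_algebra_ideal G I + target: group_algebra_ideal H J
  for G :: "'g monoid" and I and H :: "'h monoid" and J +
  fixes \<phi>
  assumes \<phi>_hom: "\<phi> \<in> alg_hom (group_algebra G) (group_algebra H)"
    and \<phi>_ideal: "\<phi> ` I \<subseteq> J"
begin

lemmas \<phi>_simps = alg_hom_group_algebra_simps[OF \<phi>_hom]

lemma \<phi>_diff:
  assumes "f \<in> carrier (group_algebra G)" "h \<in> carrier (group_algebra G)"
  shows "\<phi> (f - h) = \<phi> f - \<phi> h"
  using \<phi>_simps(3)[of "f - h" h] group_algebra_minus_closed[OF source.group_G assms] assms by simp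

text \<open>Independence of the representative: if \<open>f - h\<close> lies in \<open>I\<close>,
  then \<open>\<phi> f - \<phi> h\<close> lies in \<open>J\<close>.\<close>

lemma induced_map_coset:
  assumes "f \<in> carrier (group_algebra G)"
  shows "induced_map (group_algebra G) I (group_algebra H) J \<phi> (I +>\<^bsub>group_algebra G\<^esub> f)
    = J +>\<^bsub>group_algebra H\<^esub> \<phi> f"
proof -
  have "(\<Union>h\<in>source.coset f. target.coset (\<phi> h)) = target.coset (\<phi> f)"
    using assms \<phi>_ideal
    by (intro source.UN_coset_eq)
      (auto simp: source.coset_eq_iff target.coset_eq_iff \<phi>_simps simp flip: \<phi>_diff)
  then show ?thesis using assms by (simp add: induced_map_def source.coset_carrier)
qed

lemma induced_map_alg_hom:
  "induced_map (group_algebra G) I (group_algebra H) J \<phi> \<in> alg_hom source.Q target.Q"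
  unfolding alg_hom_def
proof (intro CollectI conjI ring_hom_memI allI ballI)
  fix x c assume "x \<in> carrier source.Q"
  then obtain f where f: "f \<in> carrier source.A" "x = source.coset f"
    by (auto simp: source.carrier_Q)
  show "induced_map source.A I target.A J \<phi> x \<in> carrier target.Q"
    using f by (simp add: induced_map_coset \<phi>_simps target.coset_carrier)
  show "induced_map source.A I target.A J \<phi> (c \<odot>\<^bsub>source.Q\<^esub> x)
      = c \<odot>\<^bsub>target.Q\<^esub> induced_map source.A I target.A J \<phi> x"
    using f by (simp add: induced_map_coset \<phi>_simps source.coset_smult target.coset_smult
        source.smult_carrier)
  fix y assume "y \<in> carrier source.Q"
  then obtain h where h: "h \<in> carrier source.A" "y = source.coset h"
    by (auto simp: source.carrier_Q)
  show "induced_map source.A I target.A J \<phi> (x \<oplus>\<^bsub>source.Q\<^esub> y) =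
      induced_map source.A I target.A J \<phi> x \<oplus>\<^bsub>target.Q\<^esub> induced_map source.A I target.A J \<phi> y"
    using f h by (simp add: induced_map_coset \<phi>_simps source.coset_add target.coset_add source.add_carrier)
  show "induced_map source.A I target.A J \<phi> (x \<otimes>\<^bsub>source.Q\<^esub> y) =
      induced_map source.A I target.A J \<phi> x \<otimes>\<^bsub>target.Q\<^esub> induced_map source.A I target.A J \<phi> y"
    using f h by (simp add: induced_map_coset \<phi>_simps source.coset_mult target.coset_mult source.mult_carrier)
next
  show "induced_map source.A I target.A J \<phi> \<one>\<^bsub>source.Q\<^esub> = \<one>\<^bsub>target.Q\<^esub>"
    by (simp add: induced_map_coset \<phi>_simps source.coset_one target.coset_one source.one_carrier)
qed

end


section \<open>Weighted maps between group algebras\<close>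

text \<open>The linear extension of \<open>a \<mapsto> \<chi> a * \<theta> a\<close>. With
  \<open>\<theta>\<close> the identity it is diagonal in the basis of group elements, which covers
  the twists, the inclusion and the projection onto degrees divisible by \<open>p\<close>; with
  constant \<open>\<theta>\<close> it turns a character \<open>\<chi>\<close> into a one-dimensional
  representation.\<close>

definition weighted_map :: "('g \<Rightarrow> 'h) \<Rightarrow> ('g \<Rightarrow> complex) \<Rightarrow> ('g \<Rightarrow>\<^sub>0 complex) \<Rightarrow> ('h \<Rightarrow>\<^sub>0 complex)" where
  "weighted_map \<theta> \<chi> f =
    (\<Sum>a\<in>Poly_Mapping.keys f. Poly_Mapping.single (\<theta> a) (\<chi> a * Poly_Mapping.lookup f a))"

text \<open>A common index set makes sums comparable when the supports differ, as for
  \<open>f\<close>, \<open>h\<close> and \<open>f + h\<close>.\<close>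

lemma weighted_map_superset:
  assumes "finite K" "Poly_Mapping.keys f \<subseteq> K"
  shows "weighted_map \<theta> \<chi> f = (\<Sum>a\<in>K. Poly_Mapping.single (\<theta> a) (\<chi> a * Poly_Mapping.lookup f a))"
  unfolding weighted_map_def using assms
  by (intro sum.mono_neutral_left) (auto simp: in_keys_iff)

lemma weighted_map_single:
  "weighted_map \<theta> \<chi> (Poly_Mapping.single a c) = Poly_Mapping.single (\<theta> a) (\<chi> a * c)"
  by (subst weighted_map_superset[of "{a}"]) auto

lemma weighted_map_zero: "weighted_map \<theta> \<chi> 0 = 0"
  by (simp add: weighted_map_def)

lemma weighted_map_add: "weighted_map \<theta> \<chi> (f + h) = weighted_map \<theta> \<chi> f + weighted_map \<theta> \<chi> h"
  using Poly_Mapping.keys_add[of f h]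
  by (simp add: weighted_map_superset[of "Poly_Mapping.keys f \<union> Poly_Mapping.keys h"] lookup_add
      distrib_left single_add sum.distrib)

lemma weighted_map_diff: "weighted_map \<theta> \<chi> (f - h) = weighted_map \<theta> \<chi> f - weighted_map \<theta> \<chi> h"
  using weighted_map_add[of \<theta> \<chi> "f - h" h] by simp

lemma weighted_map_smult:
  "weighted_map \<theta> \<chi> (c \<odot>\<^bsub>group_algebra G\<^esub> f) = c \<odot>\<^bsub>group_algebra H\<^esub> weighted_map \<theta> \<chi> f"
proof -
  have "Poly_Mapping.keys (c \<odot>\<^bsub>group_algebra G\<^esub> f) \<subseteq> Poly_Mapping.keys f"
    by (auto simp: in_keys_iff lookup_group_algebra_smult)
  then show ?thesis
    by (subst (1 2) weighted_map_superset[of "Poly_Mapping.keys f"])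
      (auto intro!: poly_mapping_eqI sum.cong
        simp: lookup_group_algebra_smult lookup_sum lookup_single sum_distrib_left when_def)
qed

lemma lookup_weighted_map_id:
  "Poly_Mapping.lookup (weighted_map (\<lambda>x. x) \<chi> f) a = \<chi> a * Poly_Mapping.lookup f a"
  by (auto simp: weighted_map_def lookup_sum lookup_single when_def in_keys_iff)

lemma weighted_map_carrier:
  assumes "\<theta> \<in> carrier G \<rightarrow> carrier H" "f \<in> carrier (group_algebra G)"
  shows "weighted_map \<theta> \<chi> f \<in> carrier (group_algebra H)"
proof -
  have "Poly_Mapping.keys (weighted_map \<theta> \<chi> f) \<subseteq> \<theta> ` Poly_Mapping.keys f"
    using keys_sum[of "\<lambda>a. Poly_Mapping.single (\<theta> a) (\<chi> a * Poly_Mapping.lookup f a)" "Poly_Mapping.keys f"]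
    by (fastforce simp: weighted_map_def split: if_splits)
  then show ?thesis using assms by (fastforce simp: group_algebra_simps)
qed

text \<open>Both sides are bilinear in \<open>f\<close> and \<open>h\<close>, so only single group
  elements matter, where the claim is multiplicativity of \<open>\<theta>\<close> and
  \<open>\<chi>\<close>.\<close>

lemma weighted_map_mult:
  assumes "\<theta> \<in> hom G H"
    and \<chi>: "\<And>a b. a \<in> carrier G \<Longrightarrow> b \<in> carrier G \<Longrightarrow> \<chi> (a \<otimes>\<^bsub>G\<^esub> b) = \<chi> a * \<chi> b"
    and f: "f \<in> carrier (group_algebra G)" and h: "h \<in> carrier (group_algebra G)"
  shows "weighted_map \<theta> \<chi> (f \<otimes>\<^bsub>group_algebra G\<^esub> h) =
    weighted_map \<theta> \<chi> f \<otimes>\<^bsub>group_algebra H\<^esub> weighted_map \<theta> \<chi> h"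
proof -
  from f have "Poly_Mapping.keys f \<subseteq> carrier G" by (simp add: group_algebra_simps)
  then show ?thesis
  proof (induction f rule: group_algebra_induct)
    case a: (single a c)
    from h have "Poly_Mapping.keys h \<subseteq> carrier G" by (simp add: group_algebra_simps)
    then show ?case
    proof (induction h rule: group_algebra_induct)
      case (single b d)
      then show ?case using a assms(1)
        by (simp add: group_algebra_single_mult weighted_map_single \<chi> hom_mult mult_ac)
    qed (simp_all add: group_algebra_distrib_left weighted_map_add group_algebra_zero_mult weighted_map_zero)
  qed (simp_all add: group_algebra_distrib_right weighted_map_add group_algebra_zero_mult weighted_map_zero)
qed

lemma weighted_map_alg_hom:
  assumes "group G" "group H" "\<theta> \<in> hom G H"
    and "\<And>a b. a \<in> carrier G \<Longrightarrow> b \<in> carrier G \<Longrightarrow> \<chi> (a \<otimes>\<^bsub>G\<^esub> b) = \<chi> a * \<chi> b"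
    and "\<chi> \<one>\<^bsub>G\<^esub> = 1"
  shows "weighted_map \<theta> \<chi> \<in> alg_hom (group_algebra G) (group_algebra H)"
  unfolding alg_hom_def
proof (intro CollectI conjI ring_hom_memI allI ballI)
  show "weighted_map \<theta> \<chi> \<one>\<^bsub>group_algebra G\<^esub> = \<one>\<^bsub>group_algebra H\<^esub>"
    using hom_one[OF assms(3,1,2)] assms(5) by (simp add: group_algebra_simps weighted_map_single)
next
  fix f assume "f \<in> carrier (group_algebra G)"
  then show "weighted_map \<theta> \<chi> f \<in> carrier (group_algebra H)"
    using assms(3) by (intro weighted_map_carrier) (auto simp: hom_def)
qed (use assms in \<open>auto simp: group_algebra_add weighted_map_add weighted_map_smult weighted_map_mult\<close>)


section \<open>The affine braid group\<close>

lemma group_braid_group: "group (braid_group n)"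
  by (simp add: braid_group_def group_presented_group)

interpretation braid: group "braid_group n" for n
  by (rule group_braid_group)

interpretation kappa: group_hom "braid_group n" integer_group kappa for n
  by (simp add: group_hom_def group_hom_axioms_def group_braid_group kappa_hom)

lemma braid_carrier: "carrier (braid_group n) =
    pres_class (braid_gens n) (braid_rels n) ` words (braid_gens n)"
  by (simp add: braid_group_def presented_group_def)

lemma braid_one: "\<one>\<^bsub>braid_group n\<^esub> = pres_class (braid_gens n) (braid_rels n) []"
  by (simp add: braid_group_def presented_group_def)

lemma braid_mult:
  "u \<in> words (braid_gens n) \<Longrightarrow> v \<in> words (braid_gens n) \<Longrightarrow>
    pres_class (braid_gens n) (braid_rels n) u \<otimes>\<^bsub>braid_group n\<^esub>
    pres_class (braid_gens n) (braid_rels n) v = pres_class (braid_gens n) (braid_rels n) (u @ v)"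
  by (simp add: braid_group_def pres_class_mult)

lemma braid_of_gen_carrier: "x \<in> braid_gens n \<Longrightarrow> braid_of_gen n x \<in> carrier (braid_group n)"
  by (auto simp: braid_carrier braid_of_gen_def words_def)

lemma braid_gens_iff: "X\<epsilon>1 \<in> braid_gens n" "T i \<in> braid_gens n \<longleftrightarrow> i \<in> {2..n}"
  by (auto simp: braid_gens_def)

lemma braid_X_carrier: "braid_of_gen n X\<epsilon>1 \<in> carrier (braid_group n)"
  by (simp add: braid_of_gen_carrier braid_gens_iff)

lemma braid_T_carrier: "i \<in> {2..n} \<Longrightarrow> braid_of_gen n (T i) \<in> carrier (braid_group n)"
  by (simp add: braid_of_gen_carrier braid_gens_iff)

lemma braid_inv_gen:
  assumes x: "x \<in> braid_gens n"
  shows "inv\<^bsub>braid_group n\<^esub> braid_of_gen n x = pres_class (braid_gens n) (braid_rels n) [(x, False)]"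
proof (rule braid.inv_equality[OF _ braid_of_gen_carrier[OF x]])
  have w: "[(x, s)] \<in> words (braid_gens n)" for s
    using x by (simp add: words_def)
  then show "pres_class (braid_gens n) (braid_rels n) [(x, False)] \<in> carrier (braid_group n)"
    by (auto simp: braid_carrier)
  have "[(x, False), (x, True)] \<in> words (braid_gens n)"
    using x by (simp add: words_def)
  then show "pres_class (braid_gens n) (braid_rels n) [(x, False)] \<otimes>\<^bsub>braid_group n\<^esub> braid_of_gen n x
      = \<one>\<^bsub>braid_group n\<^esub>"
    using pres_eq.cancel[OF x, of "braid_rels n" False]
    by (simp add: braid_one braid_of_gen_def braid_mult w pres_class_eq_iff)
qed

text \<open>Induction on a representing word, read from the left; inverse letters need their own
  case. It lets values on generators determine a homomorphism.\<close>

lemma braid_induct [consumes 1, case_names one gen inv]: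
  assumes "b \<in> carrier (braid_group n)"
    and one: "P \<one>\<^bsub>braid_group n\<^esub>"
    and gen: "\<And>x a. x \<in> braid_gens n \<Longrightarrow> a \<in> carrier (braid_group n) \<Longrightarrow> P a \<Longrightarrow>
      P (braid_of_gen n x \<otimes>\<^bsub>braid_group n\<^esub> a)"
    and inv: "\<And>x a. x \<in> braid_gens n \<Longrightarrow> a \<in> carrier (braid_group n) \<Longrightarrow> P a \<Longrightarrow>
      P (inv\<^bsub>braid_group n\<^esub> braid_of_gen n x \<otimes>\<^bsub>braid_group n\<^esub> a)"
  shows "P b"
proof -
  let ?c = "pres_class (braid_gens n) (braid_rels n)"
  have "P (?c w)" if "w \<in> words (braid_gens n)" for w
    using that
  proof (induction w)
    case Nil
    then show ?case using one by (simp add: braid_one)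
  next
    case (Cons l w)
    obtain x s where l: "l = (x, s)" by (cases l)
    have w: "w \<in> words (braid_gens n)" and x: "x \<in> braid_gens n"
      using Cons.prems l by (auto simp: words_def)
    then have lw: "[l] \<in> words (braid_gens n)" by (simp add: l words_def)
    have "?c (l # w) = ?c [l] \<otimes>\<^bsub>braid_group n\<^esub> ?c w"
      using braid_mult[OF lw w] by simp
    moreover have "?c w \<in> carrier (braid_group n)" using w by (simp add: braid_carrier)
    moreover have "?c [l] = (if s then braid_of_gen n x else inv\<^bsub>braid_group n\<^esub> braid_of_gen n x)"
      using x l by (simp add: braid_inv_gen) (simp add: braid_of_gen_def)
    ultimately show ?case
      using gen[OF x] inv[OF x] Cons.IH[OF w] by simp
  qed
  then show ?thesis using assms(1) by (auto simp: braid_carrier)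
qed

section \<open>Defining relations as identities in the braid group\<close>

lemma braid_relation:
  assumes "(pos u, pos v) \<in> braid_rels n" "set u \<subseteq> braid_gens n" "set v \<subseteq> braid_gens n"
  shows "pres_class (braid_gens n) (braid_rels n) (pos u) = pres_class (braid_gens n) (braid_rels n) (pos v)"
proof -
  have w: "pos u \<in> words (braid_gens n)" "pos v \<in> words (braid_gens n)"
    using assms by (auto simp: pos_def words_def)
  show ?thesis using pres_eq.rel[OF assms(1) w] by (simp add: pres_class_eq_iff w)
qed

text \<open>Repeated application unfolds a positive word into a product nested to the right, hence
  the bracketing of the relations below.\<close>

lemma braid_class_Cons:
  assumes "x \<in> braid_gens n" "set u \<subseteq> braid_gens n"
  shows "pres_class (braid_gens n) (braid_rels n) (pos (x # u)) =
    braid_of_gen n x \<otimes>\<^bsub>braid_group n\<^esub> pres_class (braid_gens n) (braid_rels n) (pos u)"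
proof -
  have w: "[(x, True)] \<in> words (braid_gens n)" "pos u \<in> words (braid_gens n)"
    using assms by (auto simp: pos_def words_def)
  show ?thesis using braid_mult[OF w] by (simp add: braid_of_gen_def pos_def)
qed

lemma braid_class_single: "pres_class (braid_gens n) (braid_rels n) (pos [x]) = braid_of_gen n x"
  by (simp add: pos_def braid_of_gen_def)

lemma braid_TTT:
  assumes "2 \<le> i" "i + 1 \<le> n"
  shows "braid_of_gen n (T i) \<otimes>\<^bsub>braid_group n\<^esub>
      (braid_of_gen n (T (i+1)) \<otimes>\<^bsub>braid_group n\<^esub> braid_of_gen n (T i)) =
    braid_of_gen n (T (i+1)) \<otimes>\<^bsub>braid_group n\<^esub>
      (braid_of_gen n (T i) \<otimes>\<^bsub>braid_group n\<^esub> braid_of_gen n (T (i+1)))"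
proof -
  have "(pos [T i, T (i+1), T i], pos [T (i+1), T i, T (i+1)]) \<in> braid_rels n"
    using assms unfolding braid_rels_def by blast
  from braid_relation[OF this] assms show ?thesis
    by (simp add: braid_gens_iff braid_class_Cons braid_class_single)
qed

lemma braid_XTXT:
  assumes "2 \<le> n"
  shows "braid_of_gen n X\<epsilon>1 \<otimes>\<^bsub>braid_group n\<^esub> (braid_of_gen n (T 2) \<otimes>\<^bsub>braid_group n\<^esub>
      (braid_of_gen n X\<epsilon>1 \<otimes>\<^bsub>braid_group n\<^esub> braid_of_gen n (T 2))) =
    braid_of_gen n (T 2) \<otimes>\<^bsub>braid_group n\<^esub> (braid_of_gen n X\<epsilon>1 \<otimes>\<^bsub>braid_group n\<^esub>
      (braid_of_gen n (T 2) \<otimes>\<^bsub>braid_group n\<^esub> braid_of_gen n X\<epsilon>1))"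
proof -
  have "(pos [X\<epsilon>1, T 2, X\<epsilon>1, T 2], pos [T 2, X\<epsilon>1, T 2, X\<epsilon>1]) \<in> braid_rels n"
    using assms unfolding braid_rels_def by simp
  from braid_relation[OF this] assms show ?thesis
    by (simp add: braid_gens_iff braid_class_Cons braid_class_single)
qed

lemma braid_XT:
  assumes "3 \<le> i" "i \<le> n"
  shows "braid_of_gen n X\<epsilon>1 \<otimes>\<^bsub>braid_group n\<^esub> braid_of_gen n (T i) =
    braid_of_gen n (T i) \<otimes>\<^bsub>braid_group n\<^esub> braid_of_gen n X\<epsilon>1"
proof -
  have "(pos [X\<epsilon>1, T i], pos [T i, X\<epsilon>1]) \<in> braid_rels n"
    using assms unfolding braid_rels_def by blast
  from braid_relation[OF this] assms show ?thesis
    by (simp add: braid_gens_iff braid_class_Cons braid_class_single)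
qed

lemma kappa_simps:
  "kappa \<one>\<^bsub>braid_group n\<^esub> = 0"
  "a \<in> carrier (braid_group n) \<Longrightarrow> b \<in> carrier (braid_group n) \<Longrightarrow>
    kappa (a \<otimes>\<^bsub>braid_group n\<^esub> b) = kappa a + kappa b"
  "a \<in> carrier (braid_group n) \<Longrightarrow> kappa (inv\<^bsub>braid_group n\<^esub> a) = - kappa a"
  "a \<in> carrier (braid_group n) \<Longrightarrow> kappa (a [^]\<^bsub>braid_group n\<^esub> (m::int)) = m * kappa a"
  using kappa.hom_one[of n] kappa.hom_mult[of a n b] kappa.hom_inv[of a n]
    kappa.hom_int_pow[of a n m] by (auto simp: inv_integer_group)

lemma subgroup_braid_subgroup:
  "subgroup {b \<in> carrier (braid_group n). kappa b mod int p = 0} (braid_group n)"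
  by (rule braid.subgroupI) (auto simp: kappa_simps mod_eq_0_iff_dvd intro!: exI[of _ "\<one>\<^bsub>braid_group n\<^esub>"])

lemma group_braid_subgroup: "group (braid_subgroup p n)"
  unfolding braid_subgroup_def
  by (rule subgroup.subgroup_is_group[OF subgroup_braid_subgroup group_braid_group])

section \<open>A one-dimensional character of the braid group\<close>

definition word_char :: "complex \<Rightarrow> braid_gen word \<Rightarrow> complex" where
  "word_char q w = (\<Prod>(x, s)\<leftarrow>w. if x = X\<epsilon>1 then 1 else if s then q else inverse q)"

definition braid_char :: "complex \<Rightarrow> braid \<Rightarrow> complex" where
  "braid_char q b = the_elem (word_char q ` b)"

text \<open>Every relation has equally many letters \<open>T i\<close> on both sides, so sending
  \<open>X\<epsilon>1\<close> to \<open>1\<close> and each \<open>T i\<close> to \<open>q\<close>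
  respects it; cancelling a letter against its inverse uses \<open>q \<noteq> 0\<close>.\<close>

lemma word_char_cong:
  assumes "q \<noteq> 0" and "pres_eq (braid_gens n) (braid_rels n) u v"
  shows "word_char q u = word_char q v"
  using assms(2)
proof (induction rule: pres_eq.induct)
  case (rel u v)
  then show ?case by (auto simp: braid_rels_def pos_def word_char_def split: if_splits)
qed (use assms(1) in \<open>auto simp: word_char_def\<close>)

lemma braid_char_class:
  assumes "q \<noteq> 0" "u \<in> words (braid_gens n)"
  shows "braid_char q (pres_class (braid_gens n) (braid_rels n) u) = word_char q u"
proof -
  have "word_char q ` pres_class (braid_gens n) (braid_rels n) u = {word_char q u}"
    using assms word_char_cong by (fastforce simp: pres_class_def intro: pres_eq.refl)
  then show ?thesis by (simp add: braid_char_def)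
qed

lemma braid_char_simps:
  assumes "q \<noteq> 0"
  shows "braid_char q \<one>\<^bsub>braid_group n\<^esub> = 1"
    and "a \<in> carrier (braid_group n) \<Longrightarrow> b \<in> carrier (braid_group n) \<Longrightarrow>
      braid_char q (a \<otimes>\<^bsub>braid_group n\<^esub> b) = braid_char q a * braid_char q b"
    and "braid_char q (braid_of_gen n X\<epsilon>1) = 1"
    and "i \<in> {2..n} \<Longrightarrow> braid_char q (braid_of_gen n (T i)) = q"
proof -
  show "braid_char q \<one>\<^bsub>braid_group n\<^esub> = 1"
    by (simp add: braid_one braid_char_class assms words_Nil) (simp add: word_char_def)
  show "braid_char q (braid_of_gen n X\<epsilon>1) = 1"
    by (simp add: braid_of_gen_def braid_char_class assms words_def braid_gens_iff word_char_def)
  show "braid_char q (braid_of_gen n (T i)) = q" if "i \<in> {2..n}"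
    using that by (simp add: braid_of_gen_def braid_char_class assms words_def braid_gens_iff word_char_def)
  show "braid_char q (a \<otimes>\<^bsub>braid_group n\<^esub> b) = braid_char q a * braid_char q b"
    if "a \<in> carrier (braid_group n)" "b \<in> carrier (braid_group n)"
    using that by (auto simp: braid_carrier braid_mult braid_char_class assms words_append)
      (simp add: word_char_def)
qed


section \<open>The affine Hecke algebra\<close>

text \<open>Formed for any group element, since injectivity needs it at conjugates of the
  generators. The subtraction is that of finitely supported functions, over which
  \<open>weighted_map\<close> distributes; \<open>hecke_relators_eq\<close> links it to the ring
  operations.\<close>

definition quadratic_relator :: "complex \<Rightarrow> 'g monoid \<Rightarrow> 'g \<Rightarrow> 'g \<Rightarrow>\<^sub>0 complex" where
  "quadratic_relator q G x = Poly_Mapping.single (x \<otimes>\<^bsub>G\<^esub> x) 1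
    - (Poly_Mapping.single x (q - inverse q) + Poly_Mapping.single \<one>\<^bsub>G\<^esub> 1)"

lemma quadratic_relator_carrier:
  assumes "group G" "x \<in> carrier G"
  shows "quadratic_relator q G x \<in> carrier (group_algebra G)"
proof -
  interpret group G by fact
  interpret A: ring "group_algebra G" by (rule ring_group_algebra[OF assms(1)])
  have "Poly_Mapping.single x (q - inverse q) + Poly_Mapping.single \<one>\<^bsub>G\<^esub> 1 \<in> carrier (group_algebra G)"
    using A.add.m_closed[OF single_carrier single_carrier] assms(2) by (simp add: group_algebra_add)
  then show ?thesis
    using assms(2) unfolding quadratic_relator_def
    by (intro group_algebra_minus_closed[OF assms(1)] single_carrier) auto
qed

lemma weighted_map_quadratic_relator:
  "weighted_map \<theta> \<chi> (quadratic_relator q G x) = Poly_Mapping.single (\<theta> (x \<otimes>\<^bsub>G\<^esub> x)) (\<chi> (x \<otimes>\<^bsub>G\<^esub> x))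
    - (Poly_Mapping.single (\<theta> x) (\<chi> x * (q - inverse q)) + Poly_Mapping.single (\<theta> \<one>\<^bsub>G\<^esub>) (\<chi> \<one>\<^bsub>G\<^esub>))"
  by (simp add: quadratic_relator_def weighted_map_diff weighted_map_add weighted_map_single)

lemma hecke_relators_eq:
  assumes "group G" and T: "\<And>i. i \<in> {2..n} \<Longrightarrow> braid_of_gen n (T i) \<in> carrier G"
  shows "hecke_relators q n G = (\<lambda>i. quadratic_relator q G (braid_of_gen n (T i))) ` {2..n}"
proof -
  interpret group G by fact
  interpret A: ring "group_algebra G" by (rule ring_group_algebra[OF assms(1)])
  have "(Poly_Mapping.single x 1 \<otimes>\<^bsub>group_algebra G\<^esub> Poly_Mapping.single x 1)
      \<ominus>\<^bsub>group_algebra G\<^esub> (((q - inverse q) \<odot>\<^bsub>group_algebra G\<^esub> Poly_Mapping.single x 1)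
        \<oplus>\<^bsub>group_algebra G\<^esub> \<one>\<^bsub>group_algebra G\<^esub>) = quadratic_relator q G x"
    if "x \<in> carrier G" for x
    using that A.add.m_closed[OF single_carrier single_carrier, of x "\<one>\<^bsub>G\<^esub>"]
    by (subst group_algebra_a_minus[OF assms(1)])
      (auto simp: single_carrier quadratic_relator_def group_algebra_single_mult
        group_algebra_smult_single group_algebra_add group_algebra_simps(3))
  then show ?thesis
    using T unfolding hecke_relators_def Let_def Setcompr_eq_image
    by (intro image_cong) auto
qed

text \<open>\<open>G\<close> is left open so that the braid group and its subgroup, both containing
  all \<open>T i\<close>, are treated at once.\<close>

lemma hecke_ideal_props:
  assumes G: "group G" and T: "\<And>i. i \<in> {2..n} \<Longrightarrow> braid_of_gen n (T i) \<in> carrier G"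
  shows "hecke_relators q n G \<subseteq> carrier (group_algebra G)"
    and "group_algebra_ideal G (hecke_ideal q n G)"
    and "i \<in> {2..n} \<Longrightarrow> quadratic_relator q G (braid_of_gen n (T i)) \<in> hecke_ideal q n G"
proof -
  interpret A: ring "group_algebra G" by (rule ring_group_algebra[OF G])
  show S: "hecke_relators q n G \<subseteq> carrier (group_algebra G)"
    using hecke_relators_eq[OF assms] quadratic_relator_carrier[OF G] T by auto
  show "group_algebra_ideal G (hecke_ideal q n G)"
    unfolding hecke_ideal_def using G A.genideal_ideal[OF S] by (simp add: group_algebra_ideal_def)
  show "quadratic_relator q G (braid_of_gen n (T i)) \<in> hecke_ideal q n G" if "i \<in> {2..n}"
    using A.genideal_self[OF S] that hecke_relators_eq[OF assms]
    unfolding hecke_ideal_def by auto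
qed

interpretation hecke: group_algebra_ideal "braid_group n" "hecke_ideal q n (braid_group n)" for q n
  by (rule hecke_ideal_props[OF group_braid_group braid_T_carrier])

lemma braid_subgroup_T_carrier:
  "i \<in> {2..n} \<Longrightarrow> braid_of_gen n (T i) \<in> carrier (braid_subgroup p n)"
  by (simp add: braid_subgroup_def braid_T_carrier kappa_T)

interpretation hecke_p: group_algebra_ideal "braid_subgroup p n" "hecke_ideal q n (braid_subgroup p n)"
  for q p n
  by (rule hecke_ideal_props[OF group_braid_subgroup braid_subgroup_T_carrier])

lemma quadratic_relator_mem:
  "i \<in> {2..n} \<Longrightarrow>
    quadratic_relator q (braid_group n) (braid_of_gen n (T i)) \<in> hecke_ideal q n (braid_group n)"
  "i \<in> {2..n} \<Longrightarrow>
    quadratic_relator q (braid_subgroup p n) (braid_of_gen n (T i)) \<in> hecke_ideal q n (braid_subgroup p n)"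
  by (rule hecke_ideal_props(3)[OF group_braid_group braid_T_carrier]
      hecke_ideal_props(3)[OF group_braid_subgroup braid_subgroup_T_carrier]; assumption)+

lemma affine_hecke_eq: "affine_hecke q n = hecke.Q n q"
  by (simp add: affine_hecke_def hecke_of_def)

lemma affine_hecke_p_eq: "affine_hecke_p q p n = hecke_p.Q p n q"
  by (simp add: affine_hecke_p_def hecke_of_def)

lemma hecke_gen_eq: "hecke_gen q n x = hecke.coset n q (Poly_Mapping.single (braid_of_gen n x) 1)"
  by (simp add: hecke_gen_def)

text \<open>This keeps distinct twists distinct: \<open>X\<epsilon>1\<close> must not become zero in
  the quotient. A homomorphism that kills the ideal but not \<open>X\<epsilon>1\<close> shows
  it.\<close>

lemma single_mem_hecke_ideal:
  assumes q: "q \<noteq> 0" and "Poly_Mapping.single (braid_of_gen n X\<epsilon>1) c \<in> hecke_ideal q n (braid_group n)"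
  shows "c = 0"
proof -
  \<comment> \<open>A one-dimensional character of the Hecke algebra, with values in the scalar multiples of \<open>\<one>\<close>.\<close>
  let ?B = "braid_group n" and ?\<epsilon> = "weighted_map (\<lambda>_. \<one>\<^bsub>braid_group n\<^esub>) (braid_char q)"
  have "?\<epsilon> \<in> alg_hom (group_algebra ?B) (group_algebra ?B)"
    by (intro weighted_map_alg_hom group_braid_group) (auto simp: hom_def braid_char_simps q)
  moreover have "?\<epsilon> (quadratic_relator q ?B (braid_of_gen n (T i))) = 0" if i: "i \<in> {2..n}" for i
  proof -
    \<comment> \<open>\<open>q\<close> is a root of the quadratic relation, which is why the
      character kills the relators.\<close>
    have "q * q - (q * (q - inverse q) + 1) = 0" using q by (simp add: algebra_simps)
    moreover have "braid_char q (braid_of_gen n (T i) \<otimes>\<^bsub>?B\<^esub> braid_of_gen n (T i)) = q * q"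
      using braid_char_simps(2,4)[OF q] braid_T_carrier[OF i] i by simp
    ultimately show ?thesis
      using i by (simp add: weighted_map_quadratic_relator braid_char_simps(1,4) q
          flip: single_add single_diff)
  qed
  ultimately have "?\<epsilon> ` hecke_ideal q n ?B \<subseteq> {0}"
    unfolding hecke_ideal_def
    using hecke_relators_eq[OF group_braid_group braid_T_carrier, of n q]
      ring.zeroideal[OF ring_group_algebra[OF group_braid_group, of n]]
    by (intro alg_hom_genideal[OF group_braid_group] hecke_ideal_props[OF group_braid_group braid_T_carrier])
      (auto simp: group_algebra_simps(2))
  then have "?\<epsilon> (Poly_Mapping.single (braid_of_gen n X\<epsilon>1) c) = 0" using assms(2) by blast
  then have "Poly_Mapping.single \<one>\<^bsub>?B\<^esub> c = 0"
    using q by (simp add: weighted_map_single braid_char_simps)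
  then show ?thesis by (metis lookup_single_eq lookup_zero)
qed


section \<open>The twist automorphism\<close>

definition twist :: "complex \<Rightarrow> (braid \<Rightarrow>\<^sub>0 complex) \<Rightarrow> (braid \<Rightarrow>\<^sub>0 complex)" where
  "twist \<xi> = weighted_map (\<lambda>b. b) (\<lambda>b. \<xi> powi kappa b)"

definition twist_map :: "complex \<Rightarrow> nat \<Rightarrow> complex \<Rightarrow> hecke \<Rightarrow> hecke" where
  "twist_map q n \<xi> = induced_map (group_algebra (braid_group n)) (hecke_ideal q n (braid_group n))
     (group_algebra (braid_group n)) (hecke_ideal q n (braid_group n)) (twist \<xi>)"

lemma lookup_twist: "Poly_Mapping.lookup (twist \<xi> f) b = \<xi> powi kappa b * Poly_Mapping.lookup f b"
  by (simp add: twist_def lookup_weighted_map_id)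

lemma twist_twist: "twist \<xi> (twist \<zeta> f) = twist (\<xi> * \<zeta>) f"
  by (rule poly_mapping_eqI) (simp add: lookup_twist power_int_mult_distrib)

lemma twist_one: "twist 1 f = f"
  by (rule poly_mapping_eqI) (simp add: lookup_twist)

lemma twist_single: "twist \<xi> (Poly_Mapping.single b c) = Poly_Mapping.single b (\<xi> powi kappa b * c)"
  by (simp add: twist_def weighted_map_single)

lemma twist_carrier:
  "f \<in> carrier (group_algebra G) \<Longrightarrow> twist \<xi> f \<in> carrier (group_algebra G)"
  unfolding twist_def by (rule weighted_map_carrier) auto

text \<open>Multiplicativity is additivity of \<open>kappa\<close> in the exponent; as degrees may
  be negative, this requires \<open>\<xi> \<noteq> 0\<close>.\<close>

lemma twist_alg_hom:
  assumes "\<xi> \<noteq> 0"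
  shows "twist \<xi> \<in> alg_hom (group_algebra (braid_group n)) (group_algebra (braid_group n))"
  unfolding twist_def using assms
  by (intro weighted_map_alg_hom group_braid_group) (auto simp: hom_def kappa_simps power_int_add)

text \<open>The relators involve only the \<open>T i\<close> and the unit, all of degree
  \<open>0\<close>, so the twist fixes them.\<close>

lemma twist_hecke_ideal:
  assumes "\<xi> \<noteq> 0"
  shows "twist \<xi> ` hecke_ideal q n (braid_group n) \<subseteq> hecke_ideal q n (braid_group n)"
proof -
  have "twist \<xi> (quadratic_relator q (braid_group n) (braid_of_gen n (T i))) =
      quadratic_relator q (braid_group n) (braid_of_gen n (T i))" if "i \<in> {2..n}" for i
    using that kappa_T[OF that] by (simp add: twist_def weighted_map_quadratic_relator kappa_simps braid_T_carrier)
      (simp add: quadratic_relator_def)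
  then have "twist \<xi> ` hecke_relators q n (braid_group n) \<subseteq> hecke_ideal q n (braid_group n)"
    using hecke_relators_eq[OF group_braid_group braid_T_carrier, of n q]
      quadratic_relator_mem(1)[of _ n q] by auto
  then show ?thesis
    by (subst (1) hecke_ideal_def)
      (intro alg_hom_genideal[OF group_braid_group hecke.ideal_I] twist_alg_hom assms
        hecke_ideal_props[OF group_braid_group braid_T_carrier])
qed

lemma twist_ideal_hom:
  "\<xi> \<noteq> 0 \<Longrightarrow> group_algebra_ideal_hom (braid_group n) (hecke_ideal q n (braid_group n))
     (braid_group n) (hecke_ideal q n (braid_group n)) (twist \<xi>)"
  by (intro group_algebra_ideal_hom.intro group_algebra_ideal_hom_axioms.intro
      hecke.group_algebra_ideal_axioms twist_alg_hom twist_hecke_ideal)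

lemma twist_map_coset:
  assumes "\<xi> \<noteq> 0" "f \<in> carrier (group_algebra (braid_group n))"
  shows "twist_map q n \<xi> (hecke.coset n q f) = hecke.coset n q (twist \<xi> f)"
  unfolding twist_map_def
  by (rule group_algebra_ideal_hom.induced_map_coset[OF twist_ideal_hom]) fact+

lemma affine_hecke_cases:
  assumes "x \<in> carrier (affine_hecke q n)"
  obtains f where "f \<in> carrier (group_algebra (braid_group n))" "x = hecke.coset n q f"
  using assms by (auto simp: affine_hecke_eq hecke.carrier_Q)

text \<open>Twists compose by multiplying their parameters, so the twist by
  \<open>inverse \<xi>\<close> inverts the twist by \<open>\<xi>\<close>.\<close>

lemma twist_map_alg_auto:
  assumes "\<xi> \<noteq> 0"
  shows "twist_map q n \<xi> \<in> alg_auto (affine_hecke q n)"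
proof -
  have hom: "twist_map q n \<zeta> \<in> alg_hom (affine_hecke q n) (affine_hecke q n)" if "\<zeta> \<noteq> 0" for \<zeta>
    using group_algebra_ideal_hom.induced_map_alg_hom[OF twist_ideal_hom[OF that]]
    by (simp add: affine_hecke_eq twist_map_def)
  have cl: "twist_map q n \<zeta> \<in> carrier (affine_hecke q n) \<rightarrow> carrier (affine_hecke q n)"
    if "\<zeta> \<noteq> 0" for \<zeta>
  proof (rule funcsetI)
    have "twist_map q n \<zeta> \<in> ring_hom (affine_hecke q n) (affine_hecke q n)"
      using hom[OF that] by (simp add: alg_hom_def)
    then show "x \<in> carrier (affine_hecke q n) \<Longrightarrow> twist_map q n \<zeta> x \<in> carrier (affine_hecke q n)" for x
      by (rule ring_hom_closed)
  qed
  have inv: "twist_map q n \<zeta> (twist_map q n \<eta> x) = x"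
    if "x \<in> carrier (affine_hecke q n)" "\<zeta> * \<eta> = 1" for x \<zeta> \<eta>
  proof -
    have "\<zeta> \<noteq> 0" "\<eta> \<noteq> 0" using that(2) by auto
    then show ?thesis using that
      by (elim affine_hecke_cases) (simp add: twist_map_coset twist_carrier twist_twist twist_one)
  qed
  have "bij_betw (twist_map q n \<xi>) (carrier (affine_hecke q n)) (carrier (affine_hecke q n))"
    using assms cl[of \<xi>] cl[of "inverse \<xi>"]
    by (intro bij_betw_byWitness[where f' = "twist_map q n (inverse \<xi>)"]) (auto simp: inv)
  moreover have "twist_map q n \<xi> \<in> extensional (carrier (affine_hecke q n))"
    by (simp add: twist_map_def induced_map_def affine_hecke_eq)
  ultimately show ?thesis using hom[OF assms] by (simp add: alg_auto_def Bij_def)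
qed

lemma twist_auto_twist_map:
  assumes "\<xi> \<noteq> 0"
  shows "twist_auto q n \<xi> (twist_map q n \<xi>)"
  unfolding twist_auto_def
  using assms
  by (auto simp: twist_map_alg_auto[unfolded affine_hecke_eq] hecke_gen_eq twist_map_coset single_carrier braid_X_carrier
      braid_T_carrier twist_single kappa_X kappa_T affine_hecke_eq hecke.coset_smult
      group_algebra_smult_single)

text \<open>First half of uniqueness: multiplicativity forces the value on every braid, by induction
  along a word.\<close>

lemma twist_auto_single:
  assumes g: "twist_auto q n \<xi> g" and \<xi>: "\<xi> \<noteq> 0" and b: "b \<in> carrier (braid_group n)"
  shows "g (hecke.coset n q (Poly_Mapping.single b 1)) =
    hecke.coset n q (Poly_Mapping.single b (\<xi> powi kappa b))"
proof -
  interpret A: ring "group_algebra (braid_group n)" by (rule ring_group_algebra[OF group_braid_group])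
  let ?B = "braid_group n" and ?A = "group_algebra (braid_group n)"
  let ?c = "\<lambda>b z. hecke.coset n q (Poly_Mapping.single b z)"
  have hom: "g \<in> ring_hom (hecke.Q n q) (hecke.Q n q)"
    using g by (simp add: twist_auto_def alg_auto_def alg_hom_def affine_hecke_eq)
  have mult: "?c a y \<otimes>\<^bsub>hecke.Q n q\<^esub> ?c b z = ?c (a \<otimes>\<^bsub>?B\<^esub> b) (y * z)"
    if "a \<in> carrier ?B" "b \<in> carrier ?B" for a b y z
    using that by (simp add: hecke.coset_mult single_carrier group_algebra_single_mult)
  have one: "\<one>\<^bsub>hecke.Q n q\<^esub> = ?c \<one>\<^bsub>?B\<^esub> 1"
    by (simp add: hecke.coset_one group_algebra_simps)
  have gmult: "g (?c (a \<otimes>\<^bsub>?B\<^esub> b) 1) = g (?c a 1) \<otimes>\<^bsub>hecke.Q n q\<^esub> g (?c b 1)"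
    if "a \<in> carrier ?B" "b \<in> carrier ?B" for a b
    using ring_hom_mult[OF hom, of "?c a 1" "?c b 1"] that
    by (simp add: mult hecke.coset_carrier single_carrier)
  have gone: "g (?c \<one>\<^bsub>?B\<^esub> 1) = ?c \<one>\<^bsub>?B\<^esub> 1"
    using ring_hom_one[OF hom] by (simp add: one)
  have ggen: "g (?c (braid_of_gen n x) 1) = ?c (braid_of_gen n x) (\<xi> powi kappa (braid_of_gen n x))"
    if "x \<in> braid_gens n" for x
    using g that
    by (auto simp: twist_auto_def hecke_gen_eq braid_gens_def kappa_X kappa_T affine_hecke_eq
        hecke.coset_smult single_carrier braid_X_carrier group_algebra_smult_single)
  \<comment> \<open>The image of the inverse braid is a left inverse of the class of
    \<open>?s\<close>, while \<open>?t\<close> is a right inverse of \<open>?s\<close>; in a ring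
    the two agree.\<close>
  have ginv: "g (?c (inv\<^bsub>?B\<^esub> a) 1) = ?c (inv\<^bsub>?B\<^esub> a) (inverse z)"
    if a: "a \<in> carrier ?B" and ga: "g (?c a 1) = ?c a z" and z: "z \<noteq> 0" for a z
  proof -
    have "g (?c (inv\<^bsub>?B\<^esub> a) 1) \<in> carrier (hecke.Q n q)"
      using a by (intro ring_hom_closed[OF hom] hecke.coset_carrier single_carrier) auto
    then obtain y where y: "y \<in> carrier ?A" "g (?c (inv\<^bsub>?B\<^esub> a) 1) = hecke.coset n q y"
      by (auto simp: hecke.carrier_Q)
    let ?s = "Poly_Mapping.single a z" and ?t = "Poly_Mapping.single (inv\<^bsub>?B\<^esub> a) (inverse z)"
    have st: "?s \<in> carrier ?A" "?t \<in> carrier ?A" using a by (auto intro: single_carrier)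
    have "hecke.coset n q (y \<otimes>\<^bsub>?A\<^esub> ?s) = \<one>\<^bsub>hecke.Q n q\<^esub>"
      using gmult[of "inv\<^bsub>?B\<^esub> a" a] a y st by (simp add: ga gone one hecke.coset_mult)
    moreover have "y = (y \<otimes>\<^bsub>?A\<^esub> ?s) \<otimes>\<^bsub>?A\<^esub> ?t"
    proof -
      have "?s \<otimes>\<^bsub>?A\<^esub> ?t = \<one>\<^bsub>?A\<^esub>"
        using a z by (simp add: group_algebra_single_mult group_algebra_simps(3))
      then show ?thesis using y st by (simp add: A.m_assoc)
    qed
    ultimately have "hecke.coset n q y = \<one>\<^bsub>hecke.Q n q\<^esub> \<otimes>\<^bsub>hecke.Q n q\<^esub> hecke.coset n q ?t"
      using y st by (metis hecke.coset_mult A.m_closed)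
    then show ?thesis using y a by (simp add: one mult)
  qed
  show ?thesis using b
  proof (induction b rule: braid_induct)
    case one
    then show ?case by (simp add: gone kappa_simps)
  next
    case (gen x a)
    then show ?case using \<xi>
      by (simp add: gmult ggen
          braid_of_gen_carrier mult kappa_simps power_int_add)
  next
    case (inv x a)
    then show ?case using \<xi> ginv[OF braid_of_gen_carrier ggen, of x]
      by (simp add: gmult braid_of_gen_carrier mult kappa_simps power_int_diff field_simps)
  qed
qed

text \<open>Linearity extends \<open>twist_auto_single\<close> from braids to all classes. Both maps
  are extensional, so agreement on the carrier is equality of functions.\<close>

lemma twist_auto_eq:
  assumes g: "twist_auto q n \<xi> g" and \<xi>: "\<xi> \<noteq> 0"
  shows "g = twist_map q n \<xi>"
proof (rule extensionalityI)
  show "g \<in> extensional (carrier (affine_hecke q n))"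
    using g by (simp add: twist_auto_def alg_auto_def Bij_def)
  show "twist_map q n \<xi> \<in> extensional (carrier (affine_hecke q n))"
    using twist_map_alg_auto[OF \<xi>] by (simp add: alg_auto_def Bij_def)
  have hom: "g \<in> alg_hom (hecke.Q n q) (hecke.Q n q)"
    using g by (simp add: twist_auto_def alg_auto_def affine_hecke_eq)
  have g_single: "g (hecke.coset n q (Poly_Mapping.single b c)) =
      hecke.coset n q (twist \<xi> (Poly_Mapping.single b c))" if b: "b \<in> carrier (braid_group n)" for b c
  proof -
    have "g (c \<odot>\<^bsub>hecke.Q n q\<^esub> hecke.coset n q (Poly_Mapping.single b 1)) =
        c \<odot>\<^bsub>hecke.Q n q\<^esub> hecke.coset n q (Poly_Mapping.single b (\<xi> powi kappa b))"
      using hom b twist_auto_single[OF g \<xi> b] by (simp add: alg_hom_def hecke.coset_carrier single_carrier)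
    then show ?thesis
      using b by (simp add: hecke.coset_smult single_carrier group_algebra_smult_single twist_single mult.commute)
  qed
  fix x assume "x \<in> carrier (affine_hecke q n)"
  then obtain f where f: "f \<in> carrier (group_algebra (braid_group n))" "x = hecke.coset n q f"
    by (rule affine_hecke_cases)
  have "Poly_Mapping.keys f \<subseteq> carrier (braid_group n)" using f by (simp add: group_algebra_simps)
  \<comment> \<open>Membership in the carrier joins the induction because the sum case needs it for
    both summands and the induction rule does not supply it.\<close>
  then have "f \<in> carrier (group_algebra (braid_group n)) \<and>
    g (hecke.coset n q f) = hecke.coset n q (twist \<xi> f)"
  proof (induction f rule: group_algebra_induct)
    case (single a c)
    then show ?case by (simp add: g_single single_carrier)
  next
    case (add f h)
    have "g (hecke.coset n q f \<oplus>\<^bsub>hecke.Q n q\<^esub> hecke.coset n q h) =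
        g (hecke.coset n q f) \<oplus>\<^bsub>hecke.Q n q\<^esub> g (hecke.coset n q h)"
      using hom add by (intro ring_hom_add) (auto simp: alg_hom_def hecke.coset_carrier)
    then show ?case using add
      by (simp add: hecke.coset_add hecke.add_carrier twist_carrier)
        (simp add: twist_def weighted_map_add)
  next
    case zero
    then show ?case using g_single[of "\<one>\<^bsub>braid_group n\<^esub>" 0] by (simp add: group_algebra_simps)
  qed
  then show "g x = twist_map q n \<xi> x" using f \<xi> by (simp add: twist_map_coset)
qed


section \<open>The action of the cyclic group\<close>

lemma carrier_BijGroup: "carrier (BijGroup E) = Bij E"
  and one_BijGroup: "\<one>\<^bsub>BijGroup E\<^esub> = (\<lambda>x\<in>E. x)"
  by (simp_all add: BijGroup_def)

lemma power_action_nat: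
  assumes "g \<in> Bij E" "x \<in> E"
  shows "power_action E g (int k) x = (g ^^ k) x"
proof -
  interpret group "BijGroup E" by (rule group_BijGroup)
  have carr: "g [^]\<^bsub>BijGroup E\<^esub> k \<in> Bij E" for k :: nat
    using assms nat_pow_closed[of g k] by (simp add: carrier_BijGroup)
  have "(g [^]\<^bsub>BijGroup E\<^esub> k) x = (g ^^ k) x"
  proof (induction k)
    case 0
    then show ?case using assms by (simp add: one_BijGroup)
  next
    case (Suc k)
    \<comment> \<open>The group power puts the new factor on the right, function iteration applies
      it last; \<open>nat_pow_Suc2\<close> moves it to the left.\<close>
    have "g [^]\<^bsub>BijGroup E\<^esub> Suc k = g \<otimes>\<^bsub>BijGroup E\<^esub> g [^]\<^bsub>BijGroup E\<^esub> k"
      using assms by (intro nat_pow_Suc2) (simp add: carrier_BijGroup)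
    also have "\<dots> = compose E g (g [^]\<^bsub>BijGroup E\<^esub> k)"
      using assms(1) carr[of k] unfolding BijGroup_def[of E, THEN arg_cong[of _ _ monoid.mult]] by simp
    finally show ?case using Suc assms by (simp add: compose_def)
  qed
  then show ?thesis by (simp add: power_action_def int_pow_int)
qed

text \<open>Addition in \<open>integer_mod_group p\<close> reduces modulo \<open>p\<close>; this
  makes taking powers a homomorphism from it.\<close>

lemma (in group) int_pow_mod:
  assumes "x \<in> carrier G" "x [^] (p::nat) = \<one>"
  shows "x [^] (m mod int p) = x [^] (m::int)"
proof -
  have "x [^] m = x [^] (int p * (m div int p) + m mod int p)" by simp
  also have "\<dots> = (x [^] int p) [^] (m div int p) \<otimes> x [^] (m mod int p)"
    using assms(1) by (simp only: int_pow_mult int_pow_pow)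
  finally show ?thesis using assms by (simp add: int_pow_int)
qed

lemma power_action_group_action:
  assumes "p > 0" "g \<in> Bij E" "\<And>x. x \<in> E \<Longrightarrow> (g ^^ p) x = x"
  shows "group_action (integer_mod_group p) E (power_action E g)"
proof -
  interpret group "BijGroup E" by (rule group_BijGroup)
  have g: "g \<in> carrier (BijGroup E)" using assms(2) by (simp add: carrier_BijGroup)
  have "g [^]\<^bsub>BijGroup E\<^esub> p = \<one>\<^bsub>BijGroup E\<^esub>"
  proof (rule extensionalityI)
    show "g [^]\<^bsub>BijGroup E\<^esub> p \<in> extensional E"
      using nat_pow_closed[OF g, of p] by (simp add: carrier_BijGroup Bij_def)
    show "\<one>\<^bsub>BijGroup E\<^esub> \<in> extensional E" by (simp add: one_BijGroup)
    show "(g [^]\<^bsub>BijGroup E\<^esub> p) x = \<one>\<^bsub>BijGroup E\<^esub> x" if "x \<in> E" for x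
      using power_action_nat[OF assms(2) that, of p] assms(3)[OF that] that
      by (simp add: power_action_def int_pow_int one_BijGroup)
  qed
  then have "power_action E g \<in> hom (integer_mod_group p) (BijGroup E)"
    using g by (intro homI) (simp_all add: power_action_def int_pow_mod int_pow_mult)
  then show ?thesis
    by (simp add: group_action_def group_hom_def group_hom_axioms_def group_BijGroup)
qed

text \<open>For \<open>p > 0\<close> the carrier of \<open>integer_mod_group p\<close> consists of
  \<open>0, ..., p - 1\<close>, so nonnegative exponents suffice.\<close>

lemma power_action_twist_map:
  assumes "\<xi> \<noteq> 0" "k \<ge> 0"
  shows "power_action (carrier (affine_hecke q n)) (twist_map q n \<xi>) k = twist_map q n (\<xi> ^ nat k)"
    (is "?l = ?r")
proof (rule extensionalityI)
  let ?E = "carrier (affine_hecke q n)"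
  interpret group "BijGroup ?E" by (rule group_BijGroup)
  have bij: "twist_map q n \<zeta> \<in> Bij ?E" if "\<zeta> \<noteq> 0" for \<zeta>
    using twist_map_alg_auto[OF that] by (simp add: alg_auto_def)
  show "?l \<in> extensional ?E"
    using int_pow_closed[of "twist_map q n \<xi>" k] bij[OF assms(1)]
    by (simp add: power_action_def carrier_BijGroup Bij_def)
  show "?r \<in> extensional ?E"
    using bij[of "\<xi> ^ nat k"] assms by (simp add: Bij_def)
  fix x assume x: "x \<in> ?E"
  then obtain f where f: "f \<in> carrier (group_algebra (braid_group n))" "x = hecke.coset n q f"
    by (rule affine_hecke_cases)
  have "(twist_map q n \<xi> ^^ m) x = hecke.coset n q (twist (\<xi> ^ m) f)" for m
    using assms f by (induction m) (simp_all add: twist_map_coset twist_carrier twist_twist twist_one)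
  then show "?l x = ?r x"
    using power_action_nat[OF bij[OF assms(1)] x, of "nat k"] assms f by (simp add: twist_map_coset)
qed

section \<open>Powers of a primitive root of unity and faithfulness\<close>

lemma primitive_root_nonzero: "primitive_root_of_unity p \<xi> \<Longrightarrow> p > 0 \<Longrightarrow> \<xi> \<noteq> 0"
  by (auto simp: primitive_root_of_unity_def zero_power)

text \<open>Otherwise the difference of the exponents lies strictly between \<open>0\<close> and
  \<open>p\<close>, against primitivity.\<close>

lemma primitive_root_power_inj:
  assumes "primitive_root_of_unity p \<xi>" "k < p" "l < p" "\<xi> ^ k = \<xi> ^ l"
  shows "k = l"
proof -
  have "\<xi> \<noteq> 0" using primitive_root_nonzero assms(1,2) by auto
  have "False" if "k < l" "l < p" "\<xi> ^ k = \<xi> ^ l" for k l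
  proof -
    have "\<xi> ^ k * \<xi> ^ (l - k) = \<xi> ^ l"
      using that(1) by (simp flip: power_add)
    then have "\<xi> ^ k * \<xi> ^ (l - k) = \<xi> ^ k * 1" using that(3) by simp
    then have "\<xi> ^ (l - k) = 1" using \<open>\<xi> \<noteq> 0\<close> by simp
    then show False using assms(1) that by (simp add: primitive_root_of_unity_def)
  qed
  then show ?thesis using assms by (metis nat_neq_iff)
qed

text \<open>Evaluate at \<open>X\<epsilon>1\<close>, which has degree \<open>1\<close>: the multiple
  of \<open>X\<epsilon>1\<close> by \<open>\<xi> - \<zeta>\<close> lies in the ideal, so it is
  zero.\<close>

lemma twist_map_inj:
  assumes "q \<noteq> 0" "\<xi> \<noteq> 0" "\<zeta> \<noteq> 0" "twist_map q n \<xi> = twist_map q n \<zeta>"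
  shows "\<xi> = \<zeta>"
proof -
  let ?X = "Poly_Mapping.single (braid_of_gen n X\<epsilon>1)"
  have X: "?X c \<in> carrier (group_algebra (braid_group n))" for c
    by (simp add: single_carrier braid_X_carrier)
  have "twist_map q n \<xi> (hecke.coset n q (?X 1)) = twist_map q n \<zeta> (hecke.coset n q (?X 1))"
    using assms by simp
  then have "hecke.coset n q (?X \<xi>) = hecke.coset n q (?X \<zeta>)"
    using assms(2,3) by (simp add: twist_map_coset X twist_single kappa_X)
  then have "?X (\<xi> - \<zeta>) \<in> hecke_ideal q n (braid_group n)"
    by (simp add: hecke.coset_eq_iff X single_diff)
  then show ?thesis using single_mem_hecke_ideal[OF assms(1), of n "\<xi> - \<zeta>"] by simp
qed

lemma twist_map_faithful_action:
  assumes "p > 0" "q \<noteq> 0" "primitive_root_of_unity p \<xi>"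
  shows "faithful_action (integer_mod_group p) (carrier (affine_hecke q n))
    (power_action (carrier (affine_hecke q n)) (twist_map q n \<xi>))"
proof -
  let ?E = "carrier (affine_hecke q n)"
  have \<xi>: "\<xi> \<noteq> 0" by (rule primitive_root_nonzero) fact+
  have bij: "twist_map q n \<xi> \<in> Bij ?E"
    using twist_map_alg_auto[OF \<xi>] by (simp add: alg_auto_def)
  have "(twist_map q n \<xi> ^^ p) x = x" if x: "x \<in> ?E" for x
  proof -
    have "\<xi> ^ p = 1" using assms(3) by (simp add: primitive_root_of_unity_def)
    then have "(twist_map q n \<xi> ^^ p) x = twist_map q n 1 x"
      using power_action_nat[OF bij x, of p] power_action_twist_map[OF \<xi>, of "int p" q n] by simp
    then show ?thesis using x by (elim affine_hecke_cases) (simp add: twist_map_coset twist_one)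
  qed
  moreover have "inj_on (power_action ?E (twist_map q n \<xi>)) (carrier (integer_mod_group p))"
  proof (rule inj_onI)
    fix k l assume kl: "k \<in> carrier (integer_mod_group p)" "l \<in> carrier (integer_mod_group p)"
      "power_action ?E (twist_map q n \<xi>) k = power_action ?E (twist_map q n \<xi>) l"
    then have b: "0 \<le> k" "k < int p" "0 \<le> l" "l < int p"
      using assms(1) by (auto simp: carrier_integer_mod_group)
    then have "\<xi> ^ nat k = \<xi> ^ nat l"
      using kl(3) \<xi> by (intro twist_map_inj[OF assms(2)]) (auto simp: power_action_twist_map)
    then have "nat k = nat l" using b by (intro primitive_root_power_inj[OF assms(3)]) auto
    then show "k = l" using b by simp
  qed
  ultimately show ?thesis
    using power_action_group_action[OF assms(1) bij]
    by (simp add: faithful_action_def faithful_action_axioms_def)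
qed


section \<open>The image of the natural map\<close>

lemma braid_subgroup_simps:
  "b \<in> carrier (braid_subgroup p n) \<longleftrightarrow> b \<in> carrier (braid_group n) \<and> kappa b mod int p = 0"
  "monoid.mult (braid_subgroup p n) = monoid.mult (braid_group n)"
  "\<one>\<^bsub>braid_subgroup p n\<^esub> = \<one>\<^bsub>braid_group n\<^esub>"
  by (simp_all add: braid_subgroup_def)

lemma group_algebra_braid_subgroup_mult:
  "f \<otimes>\<^bsub>group_algebra (braid_subgroup p n)\<^esub> h = f \<otimes>\<^bsub>group_algebra (braid_group n)\<^esub> h"
  by (simp add: group_algebra_def braid_subgroup_simps)

lemma quadratic_relator_braid_subgroup:
  "quadratic_relator q (braid_subgroup p n) x = quadratic_relator q (braid_group n) x"
  by (simp add: quadratic_relator_def braid_subgroup_simps)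

lemma group_algebra_braid_subgroup_carrier:
  "f \<in> carrier (group_algebra (braid_subgroup p n)) \<Longrightarrow> f \<in> carrier (group_algebra (braid_group n))"
  by (auto simp: group_algebra_simps braid_subgroup_simps)

text \<open>The inclusion of group algebras is the identity function; writing it as a weighted map
  with weight \<open>1\<close> makes \<open>weighted_map_alg_hom\<close> applicable. The relators of
  both ideals are the same elements.\<close>

lemma natural_ideal_hom:
  "group_algebra_ideal_hom (braid_subgroup p n) (hecke_ideal q n (braid_subgroup p n))
     (braid_group n) (hecke_ideal q n (braid_group n)) (\<lambda>f. f)"
proof -
  have "(\<lambda>f. f) = weighted_map (\<lambda>b::braid. b) (\<lambda>_. 1)"
    by (intro ext poly_mapping_eqI) (simp add: lookup_weighted_map_id)
  then have hom: "(\<lambda>f. f) \<in> alg_hom (group_algebra (braid_subgroup p n)) (group_algebra (braid_group n))"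
    using weighted_map_alg_hom[OF group_braid_subgroup[of p n] group_braid_group[of n], of "\<lambda>b. b" "\<lambda>_. 1"]
    by (simp add: hom_def braid_subgroup_simps)
  have "(\<lambda>f. f) ` hecke_relators q n (braid_subgroup p n) \<subseteq> hecke_ideal q n (braid_group n)"
    using hecke_relators_eq[OF group_braid_subgroup braid_subgroup_T_carrier, of n q p]
      quadratic_relator_mem(1)[of _ n q] by (auto simp: quadratic_relator_braid_subgroup)
  then have "(\<lambda>f. f) ` hecke_ideal q n (braid_subgroup p n) \<subseteq> hecke_ideal q n (braid_group n)"
    by (subst (1) hecke_ideal_def)
      (intro alg_hom_genideal[OF group_braid_subgroup hecke.ideal_I hom]
        hecke_ideal_props[OF group_braid_subgroup braid_subgroup_T_carrier])
  with hom show ?thesis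
    by (intro group_algebra_ideal_hom.intro group_algebra_ideal_hom_axioms.intro
      hecke.group_algebra_ideal_axioms hecke_p.group_algebra_ideal_axioms)
qed

lemma natural_map_eq:
  "natural_map q p n = induced_map (group_algebra (braid_subgroup p n)) (hecke_ideal q n (braid_subgroup p n))
     (group_algebra (braid_group n)) (hecke_ideal q n (braid_group n)) (\<lambda>f. f)"
  by (simp add: natural_map_def induced_map_def affine_hecke_p_eq)

lemma natural_map_coset:
  "f \<in> carrier (group_algebra (braid_subgroup p n)) \<Longrightarrow>
    natural_map q p n (hecke_p.coset p n q f) = hecke.coset n q f"
  unfolding natural_map_eq
  by (rule group_algebra_ideal_hom.induced_map_coset[OF natural_ideal_hom])

lemma natural_map_alg_hom: "natural_map q p n \<in> alg_hom (affine_hecke_p q p n) (affine_hecke q n)"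
  using group_algebra_ideal_hom.induced_map_alg_hom[OF natural_ideal_hom]
  by (simp add: natural_map_eq affine_hecke_eq affine_hecke_p_eq)

text \<open>Unless \<open>p = 1\<close>, the weight is not a character, so this projection is linear
  but not multiplicative and \<open>alg_hom_genideal\<close> does not apply to it.\<close>

definition degree_part :: "nat \<Rightarrow> (braid \<Rightarrow>\<^sub>0 complex) \<Rightarrow> (braid \<Rightarrow>\<^sub>0 complex)" where
  "degree_part p = weighted_map (\<lambda>b. b) (\<lambda>b. of_bool (kappa b mod int p = 0))"

lemma degree_part_carrier:
  "f \<in> carrier (group_algebra (braid_group n)) \<Longrightarrow>
    degree_part p f \<in> carrier (group_algebra (braid_subgroup p n))"
  by (auto simp: group_algebra_simps braid_subgroup_simps in_keys_iff degree_part_def lookup_weighted_map_id)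

lemma degree_part_ident:
  assumes "f \<in> carrier (group_algebra (braid_subgroup p n))"
  shows "degree_part p f = f"
proof (rule poly_mapping_eqI)
  fix b
  show "Poly_Mapping.lookup (degree_part p f) b = Poly_Mapping.lookup f b"
    using assms
    by (cases "b \<in> Poly_Mapping.keys f")
      (auto simp: group_algebra_simps braid_subgroup_simps degree_part_def lookup_weighted_map_id in_keys_iff)
qed

section \<open>Averaging over the powers of a primitive root of unity\<close>

lemma primitive_root_powi:
  assumes "primitive_root_of_unity p \<xi>" "p > 0"
  shows "\<xi> powi m = \<xi> ^ nat (m mod int p)"
proof -
  have \<xi>: "\<xi> \<noteq> 0" by (rule primitive_root_nonzero) fact+
  have "\<xi> powi m = \<xi> powi (int p * (m div int p) + m mod int p)" by simp
  also have "\<dots> = \<xi> powi (int p * (m div int p)) * \<xi> powi (m mod int p)"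
    using \<xi> by (intro power_int_add) simp
  also have "\<dots> = (\<xi> ^ p) powi (m div int p) * \<xi> powi (m mod int p)"
    by (simp only: power_int_power)
  finally show ?thesis using assms by (simp add: primitive_root_of_unity_def power_int_nonneg_exp)
qed

text \<open>Orthogonality of characters of the cyclic group: a geometric sum in the
  \<open>p\<close>-th root of unity \<open>?z\<close>, which vanishes unless \<open>?z = 1\<close>,
  that is, unless \<open>p\<close> divides \<open>m\<close>.\<close>

lemma sum_primitive_root_powi:
  assumes "primitive_root_of_unity p \<xi>" "p > 0"
  shows "(\<Sum>k<p. (\<xi> ^ k) powi m) = of_nat p * of_bool (m mod int p = 0)"
proof -
  let ?z = "\<xi> powi m"
  have z: "(\<xi> ^ k) powi m = ?z ^ k" for k
    by (simp add: power_int_power power_int_power' mult.commute)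
  show ?thesis
  proof (cases "m mod int p = 0")
    case True
    then show ?thesis using primitive_root_powi[OF assms, of m] by (simp add: z)
  next
    case False
    have "0 \<le> m mod int p" "m mod int p < int p" using assms(2) by auto
    then have "0 < nat (m mod int p)" "nat (m mod int p) < p" using False by auto
    then have "?z \<noteq> 1"
      using assms(1) primitive_root_powi[OF assms, of m] by (simp add: primitive_root_of_unity_def)
    moreover have "?z ^ p = 1"
      using z[of p] assms(1) by (simp add: primitive_root_of_unity_def)
    ultimately show ?thesis using False by (simp add: z geometric_sum)
  qed
qed

text \<open>Orthogonality applied to each coefficient. \<open>G\<close> is free because scalar
  multiplication does not depend on the group.\<close>

lemma sum_twist:
  assumes "primitive_root_of_unity p \<xi>" "p > 0"
  shows "(\<Sum>k<p. twist (\<xi> ^ k) f) = of_nat p \<odot>\<^bsub>group_algebra G\<^esub> degree_part p f"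
  by (rule poly_mapping_eqI)
    (simp add: lookup_sum lookup_twist lookup_group_algebra_smult degree_part_def
      lookup_weighted_map_id sum_primitive_root_powi[OF assms] flip: sum_distrib_right)

lemma twist_degree_zero:
  assumes "primitive_root_of_unity p \<xi>" "p > 0" "f \<in> carrier (group_algebra (braid_subgroup p n))"
  shows "twist (\<xi> ^ k) f = f"
proof (rule poly_mapping_eqI)
  fix b
  have "(\<xi> ^ k) powi kappa b = (\<xi> powi kappa b) ^ k"
    by (simp add: power_int_power power_int_power' mult.commute)
  then show "Poly_Mapping.lookup (twist (\<xi> ^ k) f) b = Poly_Mapping.lookup f b"
    using assms(3) primitive_root_powi[OF assms(1,2), of "kappa b"]
    by (cases "b \<in> Poly_Mapping.keys f")
      (auto simp: group_algebra_simps braid_subgroup_simps lookup_twist in_keys_iff)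
qed

text \<open>Elements of the subgroup algebra have degrees divisible by \<open>p\<close> and are
  fixed outright. Conversely, a representative of a fixed class is fixed only modulo the ideal;
  averaging replaces it by its \<open>degree_part\<close>.\<close>

lemma natural_map_image:
  assumes p: "p > 0" and \<xi>: "primitive_root_of_unity p \<xi>"
  shows "natural_map q p n ` carrier (affine_hecke_p q p n) =
    fixed_points (integer_mod_group p) (carrier (affine_hecke q n))
      (power_action (carrier (affine_hecke q n)) (twist_map q n \<xi>))" (is "?L = ?R")
proof -
  have nz: "\<xi> \<noteq> 0" by (rule primitive_root_nonzero) fact+
  have fixed: "x \<in> ?R \<longleftrightarrow> x \<in> carrier (affine_hecke q n) \<and> (\<forall>k<p. twist_map q n (\<xi> ^ k) x = x)" for x
  proof -
    have "carrier (integer_mod_group p) = int ` {..<p}"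
      using p by (simp add: carrier_integer_mod_group image_int_atLeastLessThan lessThan_atLeast0)
    then show ?thesis by (auto simp: fixed_points_def power_action_twist_map nz)
  qed
  have L: "?L = hecke.coset n q ` carrier (group_algebra (braid_subgroup p n))"
    by (simp add: affine_hecke_p_eq hecke_p.carrier_Q image_image natural_map_coset cong: image_cong_simp)
  show ?thesis
  proof (intro equalityI subsetI)
    fix x assume "x \<in> ?L"
    then obtain f where f: "f \<in> carrier (group_algebra (braid_subgroup p n))" "x = hecke.coset n q f"
      unfolding L by blast
    then show "x \<in> ?R"
      unfolding fixed using nz by (simp add: affine_hecke_eq hecke.coset_carrier group_algebra_braid_subgroup_carrier
          twist_map_coset twist_degree_zero[OF \<xi> p])
  next
    fix x assume "x \<in> ?R"
    then have x: "x \<in> carrier (affine_hecke q n)" "\<And>k. k < p \<Longrightarrow> twist_map q n (\<xi> ^ k) x = x"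
      by (auto simp: fixed)
    then obtain f where f: "f \<in> carrier (group_algebra (braid_group n))" "x = hecke.coset n q f"
      by (auto elim: affine_hecke_cases)
    let ?d = "degree_part p f" and ?A = "group_algebra (braid_group n)"
    have d: "?d \<in> carrier (group_algebra (braid_subgroup p n))" by (rule degree_part_carrier[OF f(1)])
    have "f - twist (\<xi> ^ k) f \<in> hecke_ideal q n (braid_group n)" if "k < p" for k
    proof -
      have "hecke.coset n q f = hecke.coset n q (twist (\<xi> ^ k) f)"
        using x(2)[OF that] f nz by (simp add: twist_map_coset)
      then show ?thesis using f by (simp add: hecke.coset_eq_iff twist_carrier)
    qed
    then have "(\<Sum>k<p. f - twist (\<xi> ^ k) f) \<in> hecke_ideal q n (braid_group n)"
      by (intro hecke.sum_mem) auto
    moreover have "(\<Sum>k<p. f) = of_nat p \<odot>\<^bsub>?A\<^esub> f"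
      by (rule poly_mapping_eqI) (simp add: lookup_sum lookup_group_algebra_smult)
    \<comment> \<open>The sum over \<open>k\<close> is \<open>p\<close> times \<open>f - ?d\<close>;
      since \<open>p\<close> is a nonzero scalar, \<open>f - ?d\<close> itself lies in the
      ideal.\<close>
    ultimately have "of_nat p \<odot>\<^bsub>?A\<^esub> (f - ?d) \<in> hecke_ideal q n (braid_group n)"
      by (simp add: sum_subtractf sum_twist[OF \<xi> p, of _ "braid_group n"] group_algebra_smult_minus)
    then have "hecke.coset n q f = hecke.coset n q ?d"
      using f p d by (simp add: hecke.smult_mem_iff hecke.coset_eq_iff group_algebra_braid_subgroup_carrier)
    then show "x \<in> ?L" using f d unfolding L by blast
  qed
qed


section \<open>Injectivity of the natural map\<close>

lemma group_algebra_diff_distrib: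
  "(f - f') \<otimes>\<^bsub>group_algebra G\<^esub> h = f \<otimes>\<^bsub>group_algebra G\<^esub> h - f' \<otimes>\<^bsub>group_algebra G\<^esub> h"
  "h \<otimes>\<^bsub>group_algebra G\<^esub> (f - f') = h \<otimes>\<^bsub>group_algebra G\<^esub> f - h \<otimes>\<^bsub>group_algebra G\<^esub> f'"
  using group_algebra_distrib_right[where f = "f - f'" and f' = f' and G = G and h = h]
    group_algebra_distrib_left[where f = "f - f'" and f' = f' and G = G and h = h]
  by simp_all

lemma quadratic_relator_mult_single:
  assumes "group G" "y \<in> carrier G" "b \<in> carrier G"
  shows "quadratic_relator q G y \<otimes>\<^bsub>group_algebra G\<^esub> Poly_Mapping.single b d =
    Poly_Mapping.single (y \<otimes>\<^bsub>G\<^esub> y \<otimes>\<^bsub>G\<^esub> b) d -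
    (Poly_Mapping.single (y \<otimes>\<^bsub>G\<^esub> b) ((q - inverse q) * d) + Poly_Mapping.single b d)"
proof -
  interpret group G by fact
  show ?thesis using assms
    by (simp add: quadratic_relator_def group_algebra_diff_distrib group_algebra_distrib_right
        group_algebra_single_mult)
qed

text \<open>Conjugation lets \<open>a\<close> pass the relator, since
  \<open>a x b = (a x a^-1) a b\<close>; a two-sided multiple thus becomes a one-sided one.\<close>

lemma quadratic_relator_conjugate:
  fixes G (structure)
  assumes "group G" "a \<in> carrier G" "x \<in> carrier G" "b \<in> carrier G"
  shows "Poly_Mapping.single a c \<otimes>\<^bsub>group_algebra G\<^esub> quadratic_relator q G x
      \<otimes>\<^bsub>group_algebra G\<^esub> Poly_Mapping.single b d =
    quadratic_relator q G (a \<otimes>\<^bsub>G\<^esub> x \<otimes>\<^bsub>G\<^esub> inv\<^bsub>G\<^esub> a)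
      \<otimes>\<^bsub>group_algebra G\<^esub> Poly_Mapping.single (a \<otimes>\<^bsub>G\<^esub> b) (c * d)"
proof -
  interpret group G by fact
  have canc: "inv a \<otimes> (a \<otimes> z) = z" if "z \<in> carrier G" for z
    using that assms by (simp flip: m_assoc)
  have "Poly_Mapping.single a c \<otimes>\<^bsub>group_algebra G\<^esub> quadratic_relator q G x
      \<otimes>\<^bsub>group_algebra G\<^esub> Poly_Mapping.single b d =
    Poly_Mapping.single (a \<otimes> (x \<otimes> (x \<otimes> b))) (c * d) -
    (Poly_Mapping.single (a \<otimes> (x \<otimes> b)) ((q - inverse q) * (c * d)) + Poly_Mapping.single (a \<otimes> b) (c * d))"
    using assms
    by (simp add: quadratic_relator_def group_algebra_diff_distrib group_algebra_distrib_right
        group_algebra_distrib_left group_algebra_single_mult m_assoc mult_ac)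
  then show ?thesis
    using assms by (simp add: quadratic_relator_mult_single m_assoc canc)
qed

section \<open>Conjugating the generators by elements of the subgroup\<close>

lemma (in group) int_pow_commute:
  assumes "c \<in> carrier G" "x \<in> carrier G" "c \<otimes> x = x \<otimes> c"
  shows "c [^] (m::int) \<otimes> x = x \<otimes> c [^] m"
proof -
  have pow: "c [^] k \<otimes> x = x \<otimes> c [^] k" for k :: nat
    using group_commutes_pow[OF assms(3,1,2)] .
  have "inv (c [^] k) \<otimes> x = x \<otimes> inv (c [^] k)" for k :: nat
  proof -
    let ?u = "c [^] k"
    have u: "?u \<in> carrier G" using assms by simp
    have "inv ?u \<otimes> x = inv ?u \<otimes> (x \<otimes> ?u) \<otimes> inv ?u" using u assms by (simp add: m_assoc)
    also have "\<dots> = (inv ?u \<otimes> ?u) \<otimes> x \<otimes> inv ?u"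
      using u assms unfolding pow[of k, symmetric] by (simp only: m_assoc m_closed inv_closed)
    finally show ?thesis using u assms by simp
  qed
  then show ?thesis using pow unfolding int_pow_def2 by (cases "m < 0") (simp_all del: pow_nat)
qed

lemma (in group) conjugate_mult:
  assumes "a \<in> carrier G" "d \<in> carrier G" "x \<in> carrier G"
  shows "(a \<otimes> d) \<otimes> x \<otimes> inv (a \<otimes> d) = a \<otimes> (d \<otimes> x \<otimes> inv d) \<otimes> inv a"
  using assms by (simp add: m_assoc inv_mult_group)

text \<open>Take \<open>b\<close> to be \<open>a\<close> times \<open>c^m\<close>: the power of
  \<open>c\<close> centralizes \<open>x\<close>, so the conjugate is unchanged, and \<open>m\<close>
  corrects the degree modulo \<open>p\<close>.\<close>

lemma conjugate_in_subgroup: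
  assumes "a \<in> carrier (braid_group n)" "x \<in> carrier (braid_group n)" "c \<in> carrier (braid_group n)"
    and comm: "c \<otimes>\<^bsub>braid_group n\<^esub> x = x \<otimes>\<^bsub>braid_group n\<^esub> c"
    and m: "(kappa a + m * kappa c) mod int p = 0"
  shows "\<exists>b\<in>carrier (braid_subgroup p n). a \<otimes>\<^bsub>braid_group n\<^esub> x \<otimes>\<^bsub>braid_group n\<^esub> inv\<^bsub>braid_group n\<^esub> a
    = b \<otimes>\<^bsub>braid_group n\<^esub> x \<otimes>\<^bsub>braid_group n\<^esub> inv\<^bsub>braid_group n\<^esub> b"
proof -
  let ?d = "c [^]\<^bsub>braid_group n\<^esub> m"
  have d: "?d \<in> carrier (braid_group n)" using assms by simp
  have "?d \<otimes>\<^bsub>braid_group n\<^esub> x \<otimes>\<^bsub>braid_group n\<^esub> inv\<^bsub>braid_group n\<^esub> ?d = x"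
    using braid.int_pow_commute[OF assms(3,2) comm, of m] d assms by (simp add: braid.m_assoc)
  then have "(a \<otimes>\<^bsub>braid_group n\<^esub> ?d) \<otimes>\<^bsub>braid_group n\<^esub> x \<otimes>\<^bsub>braid_group n\<^esub>
      inv\<^bsub>braid_group n\<^esub> (a \<otimes>\<^bsub>braid_group n\<^esub> ?d) =
      a \<otimes>\<^bsub>braid_group n\<^esub> x \<otimes>\<^bsub>braid_group n\<^esub> inv\<^bsub>braid_group n\<^esub> a"
    using braid.conjugate_mult[OF assms(1) d assms(2)] by simp
  moreover have "a \<otimes>\<^bsub>braid_group n\<^esub> ?d \<in> carrier (braid_subgroup p n)"
    using assms d m by (simp add: braid_subgroup_simps kappa_simps)
  ultimately show ?thesis by metis
qed

text \<open>The index \<open>j\<close> may differ from \<open>i\<close> because \<open>T 2\<close>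
  is traded for its conjugate \<open>T 3\<close> when \<open>n > 2\<close>.\<close>

lemma conjugate_T_in_subgroup:
  assumes np: "\<not> (n = 2 \<and> even p)" and i: "i \<in> {2..n}" and a: "a \<in> carrier (braid_group n)"
  shows "\<exists>j\<in>{2..n}. \<exists>b\<in>carrier (braid_subgroup p n).
    a \<otimes>\<^bsub>braid_group n\<^esub> braid_of_gen n (T i) \<otimes>\<^bsub>braid_group n\<^esub> inv\<^bsub>braid_group n\<^esub> a
    = b \<otimes>\<^bsub>braid_group n\<^esub> braid_of_gen n (T j) \<otimes>\<^bsub>braid_group n\<^esub> inv\<^bsub>braid_group n\<^esub> b"
proof -
  let ?X = "braid_of_gen n X\<epsilon>1" and ?T = "\<lambda>i. braid_of_gen n (T i)"
  note X = braid_X_carrier[of n]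
  have T: "?T i \<in> carrier (braid_group n)" if "i \<in> {2..n}" for i
    using that by (rule braid_T_carrier)
  \<comment> \<open>\<open>X\<epsilon>1\<close> commutes with \<open>T j\<close> and has degree
    \<open>1\<close>, so its power \<open>- kappa a\<close> brings the degree to exactly
    \<open>0\<close>.\<close>
  have ge3: "\<exists>b\<in>carrier (braid_subgroup p n).
      a \<otimes>\<^bsub>braid_group n\<^esub> ?T j \<otimes>\<^bsub>braid_group n\<^esub> inv\<^bsub>braid_group n\<^esub> a
      = b \<otimes>\<^bsub>braid_group n\<^esub> ?T j \<otimes>\<^bsub>braid_group n\<^esub> inv\<^bsub>braid_group n\<^esub> b"
    if "3 \<le> j" "j \<le> n" "a \<in> carrier (braid_group n)" for a j
    using that by (intro conjugate_in_subgroup[where c = ?X and m = "- kappa a"] X T braid_XT)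
      (auto simp: kappa_X)
  consider "3 \<le> i" | "i = 2" "3 \<le> n" | "i = 2" "n = 2" using i by fastforce
  then show ?thesis
  proof cases
    case 1
    then show ?thesis using ge3[of i a] i a by fastforce
  next
    case 2
    let ?d = "?T 3 \<otimes>\<^bsub>braid_group n\<^esub> ?T 2"
    have T23: "?T 2 \<in> carrier (braid_group n)" "?T 3 \<in> carrier (braid_group n)" using 2 T by auto
    \<comment> \<open>The relation \<open>T 2 T 3 T 2 = T 3 T 2 T 3\<close> says that
      \<open>?d\<close> conjugates \<open>T 3\<close> to \<open>T 2\<close>; then \<open>ge3\<close>
      applies with \<open>a\<close> replaced by \<open>a ?d\<close>.\<close>
    have "?d \<otimes>\<^bsub>braid_group n\<^esub> ?T 3 = ?T 2 \<otimes>\<^bsub>braid_group n\<^esub> ?d"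
      using braid_TTT[of 2 n] 2 T23 by (simp add: braid.m_assoc numeral_eq_Suc)
    then have "?d \<otimes>\<^bsub>braid_group n\<^esub> ?T 3 \<otimes>\<^bsub>braid_group n\<^esub> inv\<^bsub>braid_group n\<^esub> ?d = ?T 2"
      using T23 by (simp add: braid.inv_solve_right')
    then have "a \<otimes>\<^bsub>braid_group n\<^esub> ?T 2 \<otimes>\<^bsub>braid_group n\<^esub> inv\<^bsub>braid_group n\<^esub> a =
        (a \<otimes>\<^bsub>braid_group n\<^esub> ?d) \<otimes>\<^bsub>braid_group n\<^esub> ?T 3 \<otimes>\<^bsub>braid_group n\<^esub>
          inv\<^bsub>braid_group n\<^esub> (a \<otimes>\<^bsub>braid_group n\<^esub> ?d)"
      using braid.conjugate_mult[OF a braid.m_closed[OF T23(2,1)] T23(2)] by simp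
    then show ?thesis
      using ge3[of 3 "a \<otimes>\<^bsub>braid_group n\<^esub> ?d"] 2 a T23 by (intro bexI[of _ 3]) auto
  next
    case 3
    let ?z = "?X \<otimes>\<^bsub>braid_group n\<^esub> (?T 2 \<otimes>\<^bsub>braid_group n\<^esub> (?X \<otimes>\<^bsub>braid_group n\<^esub> ?T 2))"
    have T2: "?T 2 \<in> carrier (braid_group n)" using 3 T by auto
    have z: "?z \<in> carrier (braid_group n)" using X T2 by simp
    \<comment> \<open>The relation rewrites \<open>?z\<close> as
      \<open>T 2 X\<epsilon>1 T 2 X\<epsilon>1\<close>; a further \<open>T 2\<close> on the right
      gives \<open>T 2 ?z\<close> up to brackets.\<close>
    have "?z \<otimes>\<^bsub>braid_group n\<^esub> ?T 2 = ?T 2 \<otimes>\<^bsub>braid_group n\<^esub> ?z"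
    proof -
      have "?z \<otimes>\<^bsub>braid_group n\<^esub> ?T 2 = (?T 2 \<otimes>\<^bsub>braid_group n\<^esub> (?X \<otimes>\<^bsub>braid_group n\<^esub>
          (?T 2 \<otimes>\<^bsub>braid_group n\<^esub> ?X))) \<otimes>\<^bsub>braid_group n\<^esub> ?T 2"
        using braid_XTXT[of n] 3 by simp
      then show ?thesis using X T2 by (simp add: braid.m_assoc)
    qed
    moreover have "kappa ?z = 2" using X T2 3 by (simp add: kappa_simps kappa_X kappa_T)
    moreover obtain r where r: "p = 2 * r + 1" using np 3 by (auto elim: oddE)
    \<comment> \<open>\<open>r + 1\<close> inverts \<open>2\<close> modulo
      \<open>p = 2 * r + 1\<close>, whence the exponent \<open>- kappa a * (r + 1)\<close> for the
      element \<open>?z\<close> of degree \<open>2\<close>.\<close>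
    have "kappa a + (- kappa a * (int r + 1)) * 2 = - kappa a * int p"
      by (simp add: r algebra_simps)
    ultimately show ?thesis
      using conjugate_in_subgroup[OF a T2 z, of "- kappa a * (int r + 1)" p] 3 by auto
  qed
qed

text \<open>With the conjugator \<open>b\<close> in the subgroup, the relator of the conjugate is
  \<open>b\<close> times a generator of the small ideal times \<open>b^-1\<close>, all inside the
  subgroup algebra.\<close>

lemma quadratic_relator_conjugate_mem:
  assumes np: "\<not> (n = 2 \<and> even p)" and i: "i \<in> {2..n}" and a: "a \<in> carrier (braid_group n)"
  shows "quadratic_relator q (braid_group n)
      (a \<otimes>\<^bsub>braid_group n\<^esub> braid_of_gen n (T i) \<otimes>\<^bsub>braid_group n\<^esub> inv\<^bsub>braid_group n\<^esub> a)
    \<in> hecke_ideal q n (braid_subgroup p n)"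
proof -
  interpret A: ring "group_algebra (braid_group n)" by (rule ring_group_algebra[OF group_braid_group])
  interpret I: ideal "hecke_ideal q n (braid_subgroup p n)" "group_algebra (braid_subgroup p n)"
    by (rule hecke_p.ideal_I)
  obtain j b where j: "j \<in> {2..n}" and b: "b \<in> carrier (braid_subgroup p n)"
    and eq: "a \<otimes>\<^bsub>braid_group n\<^esub> braid_of_gen n (T i) \<otimes>\<^bsub>braid_group n\<^esub> inv\<^bsub>braid_group n\<^esub> a
    = b \<otimes>\<^bsub>braid_group n\<^esub> braid_of_gen n (T j) \<otimes>\<^bsub>braid_group n\<^esub> inv\<^bsub>braid_group n\<^esub> b"
    using conjugate_T_in_subgroup[OF assms] by blast
  let ?r = "quadratic_relator q (braid_group n)"
  have bB: "b \<in> carrier (braid_group n)" and bi: "inv\<^bsub>braid_group n\<^esub> b \<in> carrier (braid_subgroup p n)"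
    using b by (auto simp: braid_subgroup_simps kappa_simps mod_eq_0_iff_dvd)
  have Tj: "braid_of_gen n (T j) \<in> carrier (braid_group n)" by (rule braid_T_carrier[OF j])
  let ?f = "Poly_Mapping.single b 1 \<otimes>\<^bsub>group_algebra (braid_group n)\<^esub> ?r (braid_of_gen n (T j))
      \<otimes>\<^bsub>group_algebra (braid_group n)\<^esub> Poly_Mapping.single (inv\<^bsub>braid_group n\<^esub> b) 1"
  have "?f \<in> hecke_ideal q n (braid_subgroup p n)"
    using I.I_r_closed[OF I.I_l_closed[OF quadratic_relator_mem(2)[OF j] single_carrier[OF b]] single_carrier[OF bi]]
    by (simp add: group_algebra_braid_subgroup_mult quadratic_relator_braid_subgroup)
  moreover have "?f = ?r (b \<otimes>\<^bsub>braid_group n\<^esub> braid_of_gen n (T j) \<otimes>\<^bsub>braid_group n\<^esub> inv\<^bsub>braid_group n\<^esub> b)"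
  proof -
    have "?r y \<otimes>\<^bsub>group_algebra (braid_group n)\<^esub> Poly_Mapping.single \<one>\<^bsub>braid_group n\<^esub> 1 = ?r y"
      if "y \<in> carrier (braid_group n)" for y
      using A.r_one[OF quadratic_relator_carrier[OF group_braid_group that]]
      by (simp add: group_algebra_simps(3))
    then show ?thesis
      using quadratic_relator_conjugate[OF group_braid_group bB Tj braid.inv_closed[OF bB], of 1 q 1] bB Tj by simp
  qed
  ultimately show ?thesis by (simp add: eq)
qed

text \<open>By \<open>quadratic_relator_conjugate\<close> every multiple of a relator by two braids
  is homogeneous, so the projection keeps it or kills it; if kept, it is a multiple of a conjugate
  relator inside the subgroup algebra.\<close>

lemma degree_part_mem:
  assumes np: "\<not> (n = 2 \<and> even p)" and f: "f \<in> hecke_ideal q n (braid_group n)"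
  shows "degree_part p f \<in> hecke_ideal q n (braid_subgroup p n)"
proof -
  interpret A: ring "group_algebra (braid_group n)" by (rule ring_group_algebra[OF group_braid_group])
  interpret I: ideal "hecke_ideal q n (braid_subgroup p n)" "group_algebra (braid_subgroup p n)"
    by (rule hecke_p.ideal_I)
  let ?A = "group_algebra (braid_group n)" and ?J = "hecke_ideal q n (braid_subgroup p n)"
  let ?r = "quadratic_relator q (braid_group n)"
  have add: "degree_part p (f + h) = degree_part p f + degree_part p h" for f h
    by (simp add: degree_part_def weighted_map_add)
  have zero: "degree_part p 0 = 0" by (simp add: degree_part_def weighted_map_zero)
  \<comment> \<open>As the projection is not multiplicative, the condition covers all two-sided
    multiples; this makes \<open>K\<close> an ideal and leaves only the relators to check.\<close>
  define K where "K = {f \<in> carrier ?A. \<forall>g\<in>carrier ?A. \<forall>h\<in>carrier ?A. degree_part p (g \<otimes>\<^bsub>?A\<^esub> f \<otimes>\<^bsub>?A\<^esub> h) \<in> ?J}"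
  have "ideal K ?A"
  proof (rule A.idealI_closed)
    show "\<zero>\<^bsub>?A\<^esub> \<in> K"
      using A.zero_closed hecke_p.zero_mem
      by (simp add: K_def group_algebra_simps(2) group_algebra_zero_mult zero)
    show "x \<oplus>\<^bsub>?A\<^esub> y \<in> K" if "x \<in> K" "y \<in> K" for x y
      using that by (auto simp: K_def group_algebra_add group_algebra_distrib_left
          group_algebra_distrib_right add intro: hecke_p.add_mem hecke.add_carrier)
    show "y \<otimes>\<^bsub>?A\<^esub> x \<in> K" if "x \<in> K" "y \<in> carrier ?A" for x y
      using that by (auto simp: K_def simp flip: A.m_assoc)
    show "x \<otimes>\<^bsub>?A\<^esub> y \<in> K" if "x \<in> K" "y \<in> carrier ?A" for x y
    proof -
      have "g \<otimes>\<^bsub>?A\<^esub> (x \<otimes>\<^bsub>?A\<^esub> y) \<otimes>\<^bsub>?A\<^esub> h = g \<otimes>\<^bsub>?A\<^esub> x \<otimes>\<^bsub>?A\<^esub> (y \<otimes>\<^bsub>?A\<^esub> h)"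
        if "g \<in> carrier ?A" "h \<in> carrier ?A" for g h
        using that \<open>x \<in> K\<close> \<open>y \<in> carrier ?A\<close> by (simp add: K_def A.m_assoc)
      then show ?thesis using that by (auto simp: K_def)
    qed
  qed (auto simp: K_def)
  moreover have "?r (braid_of_gen n (T i)) \<in> K" if i: "i \<in> {2..n}" for i
  proof -
    let ?x = "braid_of_gen n (T i)"
    have x: "?x \<in> carrier (braid_group n)" by (rule braid_T_carrier[OF i])
    have g_single: "degree_part p (Poly_Mapping.single a c \<otimes>\<^bsub>?A\<^esub> ?r ?x \<otimes>\<^bsub>?A\<^esub> Poly_Mapping.single b d) \<in> ?J"
      if a: "a \<in> carrier (braid_group n)" and b: "b \<in> carrier (braid_group n)" for a b c d
    proof -
      let ?y = "a \<otimes>\<^bsub>braid_group n\<^esub> ?x \<otimes>\<^bsub>braid_group n\<^esub> inv\<^bsub>braid_group n\<^esub> a"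
        and ?e = "a \<otimes>\<^bsub>braid_group n\<^esub> b"
      have y: "?y \<in> carrier (braid_group n)" "kappa ?y = 0" and e: "?e \<in> carrier (braid_group n)"
        using a b x i by (auto simp: kappa_simps kappa_T)
      let ?f = "?r ?y \<otimes>\<^bsub>?A\<^esub> Poly_Mapping.single ?e (c * d)"
      have "degree_part p ?f \<in> ?J"
      proof (cases "kappa ?e mod int p = 0")
        case True
        then have "?e \<in> carrier (braid_subgroup p n)" using e by (simp add: braid_subgroup_simps)
        then have "?f \<in> ?J"
          using I.I_r_closed[OF quadratic_relator_conjugate_mem[OF np i a] single_carrier]
          by (simp add: group_algebra_braid_subgroup_mult)
        then show ?thesis using degree_part_ident[OF I.Icarr] by simp
      next
        case False
        \<comment> \<open>\<open>?y\<close> has degree \<open>0\<close>, so all three terms of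
          \<open>?f\<close> have the degree of \<open>?e\<close> and none survives.\<close>
        have "kappa (?y \<otimes>\<^bsub>braid_group n\<^esub> ?y \<otimes>\<^bsub>braid_group n\<^esub> ?e) = kappa ?e"
          "kappa (?y \<otimes>\<^bsub>braid_group n\<^esub> ?e) = kappa ?e"
          using kappa_simps(2)[OF y(1) e] kappa_simps(2)[OF braid.m_closed[OF y(1) y(1)] e]
            kappa_simps(2)[OF y(1) y(1)] y(2) by simp_all
        then have "degree_part p ?f = 0"
          using False unfolding quadratic_relator_mult_single[OF group_braid_group y(1) e]
          by (simp add: degree_part_def weighted_map_diff weighted_map_add weighted_map_single)
        then show ?thesis by (simp add: hecke_p.zero_mem)
      qed
      then show ?thesis using quadratic_relator_conjugate[OF group_braid_group a x b] by simp
    qed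
    have "degree_part p (g \<otimes>\<^bsub>?A\<^esub> ?r ?x \<otimes>\<^bsub>?A\<^esub> h) \<in> ?J"
      if g: "g \<in> carrier ?A" and h: "h \<in> carrier ?A" for g h
    proof -
      have "Poly_Mapping.keys g \<subseteq> carrier (braid_group n)" using g by (simp add: group_algebra_simps)
      then show ?thesis
      proof (induction g rule: group_algebra_induct)
        case a: (single a c)
        have "Poly_Mapping.keys h \<subseteq> carrier (braid_group n)" using h by (simp add: group_algebra_simps)
        then show ?case
        proof (induction h rule: group_algebra_induct)
          case (single b d)
          then show ?case by (rule g_single[OF a])
        qed (simp_all add: group_algebra_distrib_left add zero group_algebra_zero_mult
            hecke_p.add_mem hecke_p.zero_mem)
      qed (simp_all add: group_algebra_distrib_right add zero group_algebra_zero_mult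
            hecke_p.add_mem hecke_p.zero_mem)
    qed
    then show ?thesis using quadratic_relator_carrier[OF group_braid_group x] by (simp add: K_def)
  qed
  ultimately have "hecke_ideal q n (braid_group n) \<subseteq> K"
    using hecke_relators_eq[OF group_braid_group braid_T_carrier, of n q]
    unfolding hecke_ideal_def[of q n "braid_group n"] by (intro A.genideal_minimal) auto
  then have "f \<in> K" using f by blast
  then have "degree_part p (\<one>\<^bsub>?A\<^esub> \<otimes>\<^bsub>?A\<^esub> f \<otimes>\<^bsub>?A\<^esub> \<one>\<^bsub>?A\<^esub>) \<in> ?J" "f \<in> carrier ?A"
    using A.one_closed unfolding K_def by blast+
  then show ?thesis by simp
qed

text \<open>The projection does not change elements of the subgroup algebra, so a difference of
  representatives lying in the large ideal already lies in the small one.\<close>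

lemma natural_map_inj:
  assumes "\<not> (n = 2 \<and> even p)"
  shows "inj_on (natural_map q p n) (carrier (affine_hecke_p q p n))"
proof (rule inj_onI)
  fix x y assume xy: "x \<in> carrier (affine_hecke_p q p n)" "y \<in> carrier (affine_hecke_p q p n)"
    "natural_map q p n x = natural_map q p n y"
  then obtain f h where f: "f \<in> carrier (group_algebra (braid_subgroup p n))" "x = hecke_p.coset p n q f"
    and h: "h \<in> carrier (group_algebra (braid_subgroup p n))" "y = hecke_p.coset p n q h"
    by (auto simp: affine_hecke_p_eq hecke_p.carrier_Q)
  then have "f - h \<in> hecke_ideal q n (braid_group n)"
    using xy(3) by (simp add: natural_map_coset hecke.coset_eq_iff group_algebra_braid_subgroup_carrier)
  then have "degree_part p (f - h) \<in> hecke_ideal q n (braid_subgroup p n)"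
    by (rule degree_part_mem[OF assms])
  then show "x = y"
    using f h degree_part_ident[OF group_algebra_minus_closed[OF group_braid_subgroup f(1) h(1)]]
    by (simp add: hecke_p.coset_eq_iff)
qed

text \<open>Faithfulness expresses that the powers of \<open>g\<close> form a group of order exactly
  \<open>p\<close>. The equality with the fixed points is expressed through
  \<open>natural_map\<close>, as an image together with injectivity; the excluded case is the one in
  which injectivity fails, as explained at \<open>natural_map\<close>.\<close>

theorem theorem2p2:
  fixes n p :: nat and q \<xi> :: complex
  assumes "n > 0" and "p > 0" and "q \<noteq> 0"
    and "primitive_root_of_unity p \<xi>"
  shows "(\<exists>!g. twist_auto q n \<xi> g) \<and>
    (\<forall>g. twist_auto q n \<xi> g \<longrightarrow>
       faithful_action (integer_mod_group p) (carrier (affine_hecke q n))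
         (power_action (carrier (affine_hecke q n)) g) \<and>
       (\<forall>k\<in>carrier (integer_mod_group p).
          power_action (carrier (affine_hecke q n)) g k \<in> alg_auto (affine_hecke q n)) \<and>
       natural_map q p n \<in> alg_hom (affine_hecke_p q p n) (affine_hecke q n) \<and>
       natural_map q p n ` carrier (affine_hecke_p q p n) =
         fixed_points (integer_mod_group p) (carrier (affine_hecke q n))
           (power_action (carrier (affine_hecke q n)) g) \<and>
       (\<not> (n = 2 \<and> even p) \<longrightarrow>
          inj_on (natural_map q p n) (carrier (affine_hecke_p q p n))))"
proof -
  have \<xi>: "\<xi> \<noteq> 0" by (rule primitive_root_nonzero) fact+
  have "power_action (carrier (affine_hecke q n)) (twist_map q n \<xi>) k \<in> alg_auto (affine_hecke q n)"
    if "k \<in> carrier (integer_mod_group p)" for k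
    using that \<open>p > 0\<close> \<xi>
    by (simp add: carrier_integer_mod_group power_action_twist_map twist_map_alg_auto)
  \<comment> \<open>By uniqueness every admissible \<open>g\<close> equals
    \<open>twist_map q n \<xi>\<close>, so the facts about that map transfer to
    \<open>g\<close>.\<close>
  then show ?thesis
    using twist_auto_twist_map[OF \<xi>] twist_auto_eq[OF _ \<xi>] twist_map_faithful_action[OF assms(2-4)]
      natural_map_alg_hom natural_map_image[OF assms(2,4)] natural_map_inj
    by (metis (no_types, lifting))
qed

end
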